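(* For every $k\in\mathbb{N}$ let $V_k$ be a finite dimensional real vector space and let $(i^{(k)}, e^{(k)})$ be a duality structure on $V_k$. Then there exists a unique symmetric strict monoidal functor $Y\colon \mathbf{cBr}\rightarrow \mathbf{Vect}$ which satisfies $Y((k))=V_k$, $Y(i_{(k)})=i^{(k)}$ and $Y(e_{(k)})=e^{(k)}$ for all $k\in\mathbb{N}$.
   Context: $\mathbb{N}=\{0,1,2,\dots\}$. **Chromatic Brauer category.** The strict monoidal category $\mathbf{cBr}$ is defined as follows. Its objects are the finite formal tensor products $(k_1)\otimes\dots\otimes(k_m)$, $m\ge 0$, $k_i\in\mathbb{N}$ (words in the letters $(k)$, $k\in\mathbb{N}$); the tensor product is concatenation and the unit $I$ is the empty word. The dual of $X=(k_1)\otimes\dots\otimes(k_m)$ is $X^\star=(k_m)\otimes\dots\otimes(k_1)$; thus $(k)^\star=(k)$, $I^\star=I$, $X^{\star\star}=X$, $(X\otimes Y)^\star=Y^\star\otimes X^\star$. As a strict monoidal category, $\mathbf{cBr}$ is generated by morphisms $b_{X,Y}\colon X\otimes Y\to Y\otimes X$ (symmetric braiding), $i_X\colon I\to X\otimes X^\star$ (unit), $e_X\colon X^\star\otimes X\to I$ (counit), for all objects $X,Y$, subject exactly to the relations: (C1) $b_{Y,Z}\circ(f\otimes 1_Z)=(1_Z\otimes f)\circ b_{X,Z}$ and $b_{Z,Y}\circ(1_Z\otimes f)=(f\otimes 1_Z)\circ b_{Z,X}$ for all morphisms $f\colon X\to Y$ and objects $Z$; (C2) $b_{X,Y\otimes Z}=(1_Y\otimes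 b_{X,Z})\circ(b_{X,Y}\otimes 1_Z)$, $b_{X,I}=1_X$, $b_{Y,X}\circ b_{X,Y}=1_{X\otimes Y}$; (C3) $(e_X\otimes 1_{X^\star})\circ(1_{X^\star}\otimes i_X)=1_{X^\star}$, $(1_X\otimes e_X)\circ(i_X\otimes 1_X)=1_X$; (C4) $i_{X\otimes Y}=(1_X\otimes i_Y\otimes 1_{X^\star})\circ i_X$, $i_I=1_I$, $b_{X,X^\star}\circ i_X=i_{X^\star}$. In particular $i_{(k)}\colon I\to(k)\otimes(k)$ and $e_{(k)}\colon(k)\otimes(k)\to I$. **Target category.** $\mathbf{Vect}$ is the category of real vector spaces and linear maps, with the strict monoidal structure given by the Schauenburg tensor product (again denoted $\otimes$), with unit object $\mathbb{R}$. It is related to the usual tensor product $\otimes^{\mathrm{usual}}$ by a monoidal equivalence whose underlying functor is the identity of $\mathbf{Vect}$ and whose unit comparison is the identity of $\mathbb{R}$, i.e. there is a coherent natural isomorphism $\xi_{V,W}\colon V\otimes^{\mathrm{usual}}W\to V\otimes W$; one writes $v\otimes w$ for the image of the usual pure tensor. The symmetric braiding is $b_{V,W}(v\otimes w)=w\otimes v$. A symmetric strict monoidal functor $Y$ is a functor with $Y(I)=\mathbb{R}$, $Y(X\otimes X')=Y(X)\otimes Y(X')$ on objects and on morphisms, and $Y(b_{X,X'})=b_{Y(X),Y(X')}$. A duality structure on a finite dimensional real vector space $V$ is a pair $(i,e)$ of linear maps $i\colon\mathbb{R}\to V\otimes V$ (a symmetric copairing: $b_{V,V}\circ i=i$) and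 $e\colon V\otimes V\to\mathbb{R}$ (a symmetric pairing: $e\circ b_{V,V}=e$) satisfying the zig-zag equation $(e\otimes 1_V)\circ(1_V\otimes i)=1_V$. *)

theory Defs
  imports Complex_Main "HOL-Library.Indicator_Function" "HOL-Algebra.Module"
begin

section \<open>Symmetric strict monoidal categories and functors\<close>

record ('o, 'm) cat =
  Obj :: "'o set"
  Arr :: "'m set"
  Dom :: "'m \<Rightarrow> 'o"
  Cod :: "'m \<Rightarrow> 'o"
  Id :: "'o \<Rightarrow> 'm"
  Comp :: "'m \<Rightarrow> 'm \<Rightarrow> 'm"  \<comment> \<open>\<open>Comp C g f\<close> is \<open>g\<close> after \<open>f\<close>\<close>

record ('o, 'm) smcat = "('o, 'm) cat" +
  Unit :: 'o
  TensO :: "'o \<Rightarrow> 'o \<Rightarrow> 'o"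
  TensM :: "'m \<Rightarrow> 'm \<Rightarrow> 'm"
  Braid :: "'o \<Rightarrow> 'o \<Rightarrow> 'm"

definition Hom :: "('o, 'm, 'x) cat_scheme \<Rightarrow> 'o \<Rightarrow> 'o \<Rightarrow> 'm set" where
  "Hom C X Y = {f \<in> Arr C. Dom C f = X \<and> Cod C f = Y}"

locale category =
  fixes C :: "('o, 'm, 'x) cat_scheme"
  assumes Dom_Obj: "f \<in> Arr C \<Longrightarrow> Dom C f \<in> Obj C"
    and Cod_Obj: "f \<in> Arr C \<Longrightarrow> Cod C f \<in> Obj C"
    and Id_Hom: "X \<in> Obj C \<Longrightarrow> Id C X \<in> Hom C X X"
    and Comp_Hom: "f \<in> Hom C X Y \<Longrightarrow> g \<in> Hom C Y Z \<Longrightarrow> Comp C g f \<in> Hom C X Z"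
    and Comp_Id_left: "f \<in> Hom C X Y \<Longrightarrow> Comp C (Id C Y) f = f"
    and Comp_Id_right: "f \<in> Hom C X Y \<Longrightarrow> Comp C f (Id C X) = f"
    and Comp_assoc: "f \<in> Hom C W X \<Longrightarrow> g \<in> Hom C X Y \<Longrightarrow> h \<in> Hom C Y Z \<Longrightarrow>
      Comp C (Comp C h g) f = Comp C h (Comp C g f)"

locale strict_monoidal_category = category C
  for C :: "('o, 'm, 'x) smcat_scheme" +
  assumes Unit_Obj: "Unit C \<in> Obj C"
    and TensO_Obj: "X \<in> Obj C \<Longrightarrow> Y \<in> Obj C \<Longrightarrow> TensO C X Y \<in> Obj C"
    and TensM_Hom: "f \<in> Hom C X Y \<Longrightarrow> f' \<in> Hom C X' Y' \<Longrightarrow>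
      TensM C f f' \<in> Hom C (TensO C X X') (TensO C Y Y')"
    and TensM_Id: "X \<in> Obj C \<Longrightarrow> Y \<in> Obj C \<Longrightarrow>
      TensM C (Id C X) (Id C Y) = Id C (TensO C X Y)"
    and TensM_Comp: "f \<in> Hom C X Y \<Longrightarrow> g \<in> Hom C Y Z \<Longrightarrow> f' \<in> Hom C X' Y' \<Longrightarrow> g' \<in> Hom C Y' Z' \<Longrightarrow>
      TensM C (Comp C g f) (Comp C g' f') = Comp C (TensM C g g') (TensM C f f')"
    and TensO_assoc: "X \<in> Obj C \<Longrightarrow> Y \<in> Obj C \<Longrightarrow> Z \<in> Obj C \<Longrightarrow>
      TensO C (TensO C X Y) Z = TensO C X (TensO C Y Z)"
    and TensO_Unit_left: "X \<in> Obj C \<Longrightarrow> TensO C (Unit C) X = X"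
    and TensO_Unit_right: "X \<in> Obj C \<Longrightarrow> TensO C X (Unit C) = X"
    and TensM_assoc: "f \<in> Arr C \<Longrightarrow> g \<in> Arr C \<Longrightarrow> h \<in> Arr C \<Longrightarrow>
      TensM C (TensM C f g) h = TensM C f (TensM C g h)"
    and TensM_Unit_left: "f \<in> Arr C \<Longrightarrow> TensM C (Id C (Unit C)) f = f"
    and TensM_Unit_right: "f \<in> Arr C \<Longrightarrow> TensM C f (Id C (Unit C)) = f"

locale symmetric_strict_monoidal_category = strict_monoidal_category C
  for C :: "('o, 'm, 'x) smcat_scheme" +
  assumes Braid_Hom: "X \<in> Obj C \<Longrightarrow> Y \<in> Obj C \<Longrightarrow>
      Braid C X Y \<in> Hom C (TensO C X Y) (TensO C Y X)"
    and Braid_natural: "f \<in> Hom C X Y \<Longrightarrow> f' \<in> Hom C X' Y' \<Longrightarrow>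
      Comp C (Braid C Y Y') (TensM C f f') = Comp C (TensM C f' f) (Braid C X X')"
    and Braid_TensO: "X \<in> Obj C \<Longrightarrow> Y \<in> Obj C \<Longrightarrow> Z \<in> Obj C \<Longrightarrow>
      Braid C X (TensO C Y Z) =
        Comp C (TensM C (Id C Y) (Braid C X Z)) (TensM C (Braid C X Y) (Id C Z))"
    and Braid_Unit: "X \<in> Obj C \<Longrightarrow> Braid C X (Unit C) = Id C X"
    and Braid_Braid: "X \<in> Obj C \<Longrightarrow> Y \<in> Obj C \<Longrightarrow>
      Comp C (Braid C Y X) (Braid C X Y) = Id C (TensO C X Y)"

datatype ('o, 'm, 'p, 'n) func = Func (on_obj: "'o \<Rightarrow> 'p") (on_arr: "'m \<Rightarrow> 'n")

text \<open>
  Both maps of a functor are extensional, so that equality of terms of type \<open>func\<close> is equality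
  of functors.
\<close>

definition symmetric_strict_monoidal_functor ::
  "('o, 'm, 'x) smcat_scheme \<Rightarrow> ('p, 'n, 'y) smcat_scheme \<Rightarrow> ('o, 'm, 'p, 'n) func \<Rightarrow> bool" where
  "symmetric_strict_monoidal_functor C D F \<longleftrightarrow>
     on_obj F \<in> Obj C \<rightarrow>\<^sub>E Obj D \<and>
     on_arr F \<in> Arr C \<rightarrow>\<^sub>E Arr D \<and>
     (\<forall>f\<in>Arr C. Dom D (on_arr F f) = on_obj F (Dom C f) \<and> Cod D (on_arr F f) = on_obj F (Cod C f)) \<and>
     (\<forall>X\<in>Obj C. on_arr F (Id C X) = Id D (on_obj F X)) \<and>
     (\<forall>f\<in>Arr C. \<forall>g\<in>Arr C. Dom C g = Cod C f \<longrightarrow>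
        on_arr F (Comp C g f) = Comp D (on_arr F g) (on_arr F f)) \<and>
     on_obj F (Unit C) = Unit D \<and>
     (\<forall>X\<in>Obj C. \<forall>Y\<in>Obj C. on_obj F (TensO C X Y) = TensO D (on_obj F X) (on_obj F Y)) \<and>
     (\<forall>f\<in>Arr C. \<forall>g\<in>Arr C. on_arr F (TensM C f g) = TensM D (on_arr F f) (on_arr F g)) \<and>
     (\<forall>X\<in>Obj C. \<forall>Y\<in>Obj C. on_arr F (Braid C X Y) = Braid D (on_obj F X) (on_obj F Y))"


section \<open>The chromatic Brauer category\<close>

text \<open>
  The object \<open>(k\<^sub>1) \<otimes> \<dots> \<otimes> (k\<^sub>m)\<close> is the list \<open>[k\<^sub>1, \<dots>, k\<^sub>m]\<close>; tensor product is \<open>@\<close>, the unit object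
  is \<open>[]\<close> and the dual is \<open>rev\<close>.  Morphisms are well-formed formal expressions in the generators,
  modulo the congruence generated by the laws of a strict monoidal category, the naturality and
  coherence of the braiding, the zig-zag equations and the compatibilities of the units.
\<close>

datatype br_expr =
    EId "nat list"
  | EBraid "nat list" "nat list"
  | EUnit "nat list"
  | ECounit "nat list"
  | EComp br_expr br_expr
  | ETens br_expr br_expr

primrec edom :: "br_expr \<Rightarrow> nat list" where
  "edom (EId X) = X"
| "edom (EBraid X Y) = X @ Y"
| "edom (EUnit X) = []"
| "edom (ECounit X) = rev X @ X"
| "edom (EComp g f) = edom f"
| "edom (ETens f g) = edom f @ edom g"

primrec ecod :: "br_expr \<Rightarrow> nat list" where
  "ecod (EId X) = X"
| "ecod (EBraid X Y) = Y @ X"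
| "ecod (EUnit X) = X @ rev X"
| "ecod (ECounit X) = []"
| "ecod (EComp g f) = ecod g"
| "ecod (ETens f g) = ecod f @ ecod g"

primrec wf_expr :: "br_expr \<Rightarrow> bool" where
  "wf_expr (EId X) = True"
| "wf_expr (EBraid X Y) = True"
| "wf_expr (EUnit X) = True"
| "wf_expr (ECounit X) = True"
| "wf_expr (EComp g f) = (wf_expr g \<and> wf_expr f \<and> edom g = ecod f)"
| "wf_expr (ETens f g) = (wf_expr f \<and> wf_expr g)"

inductive br_eq :: "br_expr \<Rightarrow> br_expr \<Rightarrow> bool" (infix \<open>\<approx>\<close> 50) where
  refl: "wf_expr f \<Longrightarrow> f \<approx> f"
| sym: "f \<approx> g \<Longrightarrow> g \<approx> f"
| trans: "f \<approx> g \<Longrightarrow> g \<approx> h \<Longrightarrow> f \<approx> h"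
| cong_Comp: "f \<approx> f' \<Longrightarrow> g \<approx> g' \<Longrightarrow> edom g = ecod f \<Longrightarrow> EComp g f \<approx> EComp g' f'"
| cong_Tens: "f \<approx> f' \<Longrightarrow> g \<approx> g' \<Longrightarrow> ETens f g \<approx> ETens f' g'"
| Comp_Id_left: "wf_expr f \<Longrightarrow> EComp (EId (ecod f)) f \<approx> f"
| Comp_Id_right: "wf_expr f \<Longrightarrow> EComp f (EId (edom f)) \<approx> f"
| Comp_assoc: "wf_expr f \<Longrightarrow> wf_expr g \<Longrightarrow> wf_expr h \<Longrightarrow> edom g = ecod f \<Longrightarrow> edom h = ecod g \<Longrightarrow>
    EComp (EComp h g) f \<approx> EComp h (EComp g f)"
| Tens_Id: "ETens (EId X) (EId Y) \<approx> EId (X @ Y)"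
| Tens_Comp: "wf_expr f \<Longrightarrow> wf_expr g \<Longrightarrow> wf_expr f' \<Longrightarrow> wf_expr g' \<Longrightarrow>
    edom g = ecod f \<Longrightarrow> edom g' = ecod f' \<Longrightarrow>
    ETens (EComp g f) (EComp g' f') \<approx> EComp (ETens g g') (ETens f f')"
| Tens_assoc: "wf_expr f \<Longrightarrow> wf_expr g \<Longrightarrow> wf_expr h \<Longrightarrow>
    ETens (ETens f g) h \<approx> ETens f (ETens g h)"
| Tens_Unit_left: "wf_expr f \<Longrightarrow> ETens (EId []) f \<approx> f"
| Tens_Unit_right: "wf_expr f \<Longrightarrow> ETens f (EId []) \<approx> f"
| Braid_natural_left: "wf_expr f \<Longrightarrow> edom f = X \<Longrightarrow> ecod f = Y \<Longrightarrow>
    EComp (EBraid Y Z) (ETens f (EId Z)) \<approx> EComp (ETens (EId Z) f) (EBraid X Z)"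
| Braid_natural_right: "wf_expr f \<Longrightarrow> edom f = X \<Longrightarrow> ecod f = Y \<Longrightarrow>
    EComp (EBraid Z Y) (ETens (EId Z) f) \<approx> EComp (ETens f (EId Z)) (EBraid Z X)"
| Braid_Tens: "EBraid X (Y @ Z) \<approx> EComp (ETens (EId Y) (EBraid X Z)) (ETens (EBraid X Y) (EId Z))"
| Braid_Unit: "EBraid X [] \<approx> EId X"
| Braid_inv: "EComp (EBraid Y X) (EBraid X Y) \<approx> EId (X @ Y)"
| zigzag_left: "EComp (ETens (ECounit X) (EId (rev X))) (ETens (EId (rev X)) (EUnit X)) \<approx> EId (rev X)"
| zigzag_right: "EComp (ETens (EId X) (ECounit X)) (ETens (EUnit X) (EId X)) \<approx> EId X"
| Unit_Tens: "EUnit (X @ Y) \<approx> EComp (ETens (ETens (EId X) (EUnit Y)) (EId (rev X))) (EUnit X)"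
| Unit_Unit: "EUnit [] \<approx> EId []"
| Unit_Braid: "EComp (EBraid X (rev X)) (EUnit X) \<approx> EUnit (rev X)"

definition br_class :: "br_expr \<Rightarrow> br_expr set" where
  "br_class f = {g. f \<approx> g}"

definition br_rep :: "br_expr set \<Rightarrow> br_expr" where
  "br_rep A = (SOME f. f \<in> A)"

definition cBr :: "(nat list, br_expr set) smcat" where
  "cBr = \<lparr>Obj = UNIV,
     Arr = br_class ` {f. wf_expr f},
     Dom = (\<lambda>A. edom (br_rep A)),
     Cod = (\<lambda>A. ecod (br_rep A)),
     Id = (\<lambda>X. br_class (EId X)),
     Comp = (\<lambda>B A. br_class (EComp (br_rep B) (br_rep A))),
     Unit = [],
     TensO = (@),
     TensM = (\<lambda>A B. br_class (ETens (br_rep A) (br_rep B))),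
     Braid = (\<lambda>X Y. br_class (EBraid X Y))\<rparr>"

definition cBr_unit :: "nat list \<Rightarrow> br_expr set" where
  "cBr_unit X = br_class (EUnit X)"

definition cBr_counit :: "nat list \<Rightarrow> br_expr set" where
  "cBr_counit X = br_class (ECounit X)"

lemma br_eq_wf: "f \<approx> g \<Longrightarrow> wf_expr f \<and> wf_expr g \<and> edom f = edom g \<and> ecod f = ecod g"
  by (induction rule: br_eq.induct) auto

lemma br_class_eq_iff: "wf_expr f \<Longrightarrow> br_class f = br_class g \<longleftrightarrow> f \<approx> g"
  unfolding br_class_def set_eq_iff mem_Collect_eq
  by (meson br_eq.refl br_eq.sym br_eq.trans)

lemma br_rep_class: "wf_expr f \<Longrightarrow> f \<approx> br_rep (br_class f)"
  unfolding br_rep_def br_class_def mem_Collect_eq by (rule someI) (rule br_eq.refl)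

lemma cBr_Hom: "A \<in> Hom cBr X Y \<longleftrightarrow> (\<exists>f. A = br_class f \<and> wf_expr f \<and> edom f = X \<and> ecod f = Y)"
  using br_eq_wf br_rep_class by (fastforce simp: Hom_def cBr_def)

lemma cBr_Comp:
  assumes "wf_expr f" "wf_expr g" "edom g = ecod f"
  shows "Comp cBr (br_class g) (br_class f) = br_class (EComp g f)"
proof -
  have "EComp g f \<approx> EComp (br_rep (br_class g)) (br_rep (br_class f))"
    by (intro br_eq.cong_Comp br_rep_class assms)
  then show ?thesis using assms by (simp add: cBr_def br_class_eq_iff[symmetric])
qed

lemma cBr_TensM:
  assumes "wf_expr f" "wf_expr g"
  shows "TensM cBr (br_class f) (br_class g) = br_class (ETens f g)"
proof -
  have "ETens f g \<approx> ETens (br_rep (br_class f)) (br_rep (br_class g))"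
    by (intro br_eq.cong_Tens br_rep_class assms)
  then show ?thesis using assms by (simp add: cBr_def br_class_eq_iff[symmetric])
qed

lemma cBr_simps:
  "Obj cBr = UNIV" "Id cBr X = br_class (EId X)" "Unit cBr = []" "TensO cBr X Y = X @ Y"
  "Braid cBr X Y = br_class (EBraid X Y)"
  by (simp_all add: cBr_def)

lemma cBr_Arr: "A \<in> Arr cBr \<longleftrightarrow> (\<exists>f. A = br_class f \<and> wf_expr f)"
  by (auto simp: cBr_def)

lemma br_eq_Braid_natural:
  assumes "wf_expr f" "wf_expr g"
  shows "EComp (EBraid (ecod f) (ecod g)) (ETens f g) \<approx> EComp (ETens g f) (EBraid (edom f) (edom g))"
    (is "?L \<approx> ?R")
proof -
  let ?X = "edom f" and ?Y = "ecod f" and ?X' = "edom g" and ?Y' = "ecod g"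
  let ?b = "EBraid ?Y ?Y'"
  note wf = assms
  have 1: "ETens f g \<approx> EComp (ETens f (EId ?Y')) (ETens (EId ?X) g)"
    by (rule br_eq.trans[OF br_eq.cong_Tens[OF br_eq.sym[OF br_eq.Comp_Id_right[OF wf(1)]]
          br_eq.sym[OF br_eq.Comp_Id_left[OF wf(2)]]]]) (rule br_eq.Tens_Comp; simp add: wf)
  have 2: "ETens g f \<approx> EComp (ETens (EId ?Y') f) (ETens g (EId ?X))"
    by (rule br_eq.trans[OF br_eq.cong_Tens[OF br_eq.sym[OF br_eq.Comp_Id_left[OF wf(2)]]
          br_eq.sym[OF br_eq.Comp_Id_right[OF wf(1)]]]]) (rule br_eq.Tens_Comp; simp add: wf)
  have "?L \<approx> EComp ?b (EComp (ETens f (EId ?Y')) (ETens (EId ?X) g))"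
    by (rule br_eq.cong_Comp[OF 1 br_eq.refl]) simp_all
  moreover have "\<dots> \<approx> EComp (EComp ?b (ETens f (EId ?Y'))) (ETens (EId ?X) g)"
    by (rule br_eq.sym, rule br_eq.Comp_assoc) (simp_all add: wf)
  moreover have "\<dots> \<approx> EComp (EComp (ETens (EId ?Y') f) (EBraid ?X ?Y')) (ETens (EId ?X) g)"
    by (rule br_eq.cong_Comp[OF br_eq.refl br_eq.Braid_natural_left]) (simp_all add: wf)
  moreover have "\<dots> \<approx> EComp (ETens (EId ?Y') f) (EComp (EBraid ?X ?Y') (ETens (EId ?X) g))"
    by (rule br_eq.Comp_assoc) (simp_all add: wf)
  moreover have "\<dots> \<approx> EComp (ETens (EId ?Y') f) (EComp (ETens g (EId ?X)) (EBraid ?X ?X'))"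
    by (rule br_eq.cong_Comp[OF br_eq.Braid_natural_right br_eq.refl]) (simp_all add: wf)
  moreover have "\<dots> \<approx> EComp (EComp (ETens (EId ?Y') f) (ETens g (EId ?X))) (EBraid ?X ?X')"
    by (rule br_eq.sym, rule br_eq.Comp_assoc) (simp_all add: wf)
  moreover have "\<dots> \<approx> ?R"
    by (rule br_eq.cong_Comp[OF br_eq.refl br_eq.sym[OF 2]]) (simp_all add: wf)
  ultimately show ?thesis by (meson br_eq.trans)
qed

lemma br_class_eqI: "f \<approx> g \<Longrightarrow> br_class f = br_class g"
  using br_class_eq_iff br_eq_wf by blast

lemma cBr_HomI: "wf_expr f \<Longrightarrow> edom f = X \<Longrightarrow> ecod f = Y \<Longrightarrow> br_class f \<in> Hom cBr X Y"
  by (auto simp: cBr_Hom)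

lemma symmetric_strict_monoidal_category_cBr: "symmetric_strict_monoidal_category cBr"
proof unfold_locales
  fix f f' X Y X' Y'
  assume "f \<in> Hom cBr X Y" "f' \<in> Hom cBr X' Y'"
  then show "Comp cBr (Braid cBr Y Y') (TensM cBr f f') = Comp cBr (TensM cBr f' f) (Braid cBr X X')"
    by (auto simp: cBr_Hom cBr_Comp cBr_TensM cBr_simps intro!: br_class_eqI br_eq_Braid_natural del: equalityI)
qed (auto simp: cBr_Hom cBr_Arr cBr_Comp cBr_TensM cBr_simps simp del: split_paired_Ex
      intro!: br_class_eqI cBr_HomI[unfolded cBr_Hom] intro: br_eq.intros del: equalityI)


section \<open>Real vector spaces\<close>

definition real_ring :: "real ring" where
  "real_ring = \<lparr>carrier = UNIV, mult = (*), one = 1, zero = 0, add = (+)\<rparr>"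

text \<open>
  The library's record for modules has ring fields \<open>mult\<close> and \<open>one\<close> that play no role, and its
  operations are total.  Fixing the irrelevant values makes equality of records the same as
  equality of vector spaces.
\<close>

definition real_vs :: "(real, 'a) module \<Rightarrow> bool" where
  "real_vs V \<longleftrightarrow> module real_ring V \<and> mult V = undefined \<and> one V = undefined \<and>
     case_prod (add V) \<in> extensional (carrier V \<times> carrier V) \<and>
     case_prod (smult V) \<in> extensional (UNIV \<times> carrier V)"

definition fin_dim :: "(real, 'a) module \<Rightarrow> bool" where
  "fin_dim V \<longleftrightarrow> (\<exists>B. finite B \<and> B \<subseteq> carrier V \<and>
     (\<forall>x\<in>carrier V. \<exists>a :: 'a \<Rightarrow> real. x = (\<Oplus>\<^bsub>V\<^esub>b\<in>B. a b \<odot>\<^bsub>V\<^esub> b)))"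

definition linear_maps :: "(real, 'a) module \<Rightarrow> (real, 'b) module \<Rightarrow> ('a \<Rightarrow> 'b) set" where
  "linear_maps V W = {f \<in> carrier V \<rightarrow>\<^sub>E carrier W.
     (\<forall>x\<in>carrier V. \<forall>y\<in>carrier V. f (x \<oplus>\<^bsub>V\<^esub> y) = f x \<oplus>\<^bsub>W\<^esub> f y) \<and>
     (\<forall>a. \<forall>x\<in>carrier V. f (a \<odot>\<^bsub>V\<^esub> x) = a \<odot>\<^bsub>W\<^esub> f x)}"

text \<open>
  The category of real vector spaces whose underlying sets are subsets of \<open>'a\<close>; the type \<open>'a\<close>
  plays the part of the universe of sets.
\<close>

datatype 'a lin_map =
  Lin (lin_dom: "(real, 'a) module") (lin_fun: "'a \<Rightarrow> 'a") (lin_cod: "(real, 'a) module")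

definition Vect :: "((real, 'a) module, 'a lin_map) cat" where
  "Vect = \<lparr>Obj = {V. real_vs V},
     Arr = {Lin V f W | V f W. real_vs V \<and> real_vs W \<and> f \<in> linear_maps V W},
     Dom = lin_dom,
     Cod = lin_cod,
     Id = (\<lambda>V. Lin V (\<lambda>x\<in>carrier V. x) V),
     Comp = (\<lambda>g f. Lin (lin_dom f) (compose (carrier (lin_dom f)) (lin_fun g) (lin_fun f)) (lin_cod g))\<rparr>"

lemma category_Vect: "category Vect"
proof
  have *: "f \<in> Hom Vect V W \<longleftrightarrow>
    real_vs V \<and> real_vs W \<and> f = Lin V (lin_fun f) W \<and> lin_fun f \<in> linear_maps V W" for f V W
    by (cases f) (auto simp: Hom_def Vect_def)
  have c: "x \<oplus>\<^bsub>V\<^esub> y \<in> carrier V" "a \<odot>\<^bsub>V\<^esub> x \<in> carrier V"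
    if "real_vs V" "x \<in> carrier V" "y \<in> carrier V" for V :: "(real, 'a) module" and x y a
  proof -
    interpret module real_ring V using that by (simp add: real_vs_def)
    show "x \<oplus>\<^bsub>V\<^esub> y \<in> carrier V" "a \<odot>\<^bsub>V\<^esub> x \<in> carrier V" using that
      by (auto intro!: smult_closed simp: real_ring_def)
  qed
  fix f g h :: "'a lin_map" and W X Y Z :: "(real, 'a) module"
  show "X \<in> Obj Vect \<Longrightarrow> cat.Id Vect X \<in> Hom Vect X X"
    unfolding * by (auto simp: Vect_def linear_maps_def c)
  show "f \<in> Arr Vect \<Longrightarrow> Dom Vect f \<in> Obj Vect" "f \<in> Arr Vect \<Longrightarrow> Cod Vect f \<in> Obj Vect"
    by (auto simp: Vect_def)
  show "f \<in> Hom Vect X Y \<Longrightarrow> g \<in> Hom Vect Y Z \<Longrightarrow> Comp Vect g f \<in> Hom Vect X Z"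
    unfolding * by (cases f; cases g) (auto simp: Vect_def linear_maps_def c compose_def PiE_iff)
  show "f \<in> Hom Vect X Y \<Longrightarrow> Comp Vect (cat.Id Vect Y) f = f"
   unfolding * by (cases f) (auto simp: Vect_def linear_maps_def compose_def PiE_iff extensional_def fun_eq_iff)
  show "f \<in> Hom Vect X Y \<Longrightarrow> Comp Vect f (cat.Id Vect X) = f"
   unfolding * by (cases f) (auto simp: Vect_def linear_maps_def compose_def PiE_iff extensional_def fun_eq_iff)
  show "f \<in> Hom Vect W X \<Longrightarrow> g \<in> Hom Vect X Y \<Longrightarrow> h \<in> Hom Vect Y Z \<Longrightarrow>
    Comp Vect (Comp Vect h g) f = Comp Vect h (Comp Vect g f)"
   unfolding * by (cases f; cases g; cases h) (auto simp: Vect_def linear_maps_def compose_def PiE_iff fun_eq_iff)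
qed

text \<open>
  Taking \<open>real + 'a\<close> as universe makes the real line itself an object, whatever \<open>'a\<close> is.
\<close>

definition real_line :: "(real, real + 'a) module" where
  "real_line = \<lparr>carrier = range Inl, mult = undefined, one = undefined, zero = Inl 0,
     add = (\<lambda>x y. if x \<in> range Inl \<and> y \<in> range Inl then Inl (projl x + projl y) else undefined),
     smult = (\<lambda>a x. if x \<in> range Inl then Inl (a * projl x) else undefined)\<rparr>"

lemma real_ring_cring: "cring real_ring"
  by (rule cringI; (rule abelian_groupI comm_monoidI)?) (auto simp: real_ring_def algebra_simps intro: exI[of _ "- x" for x])

lemma real_vs_real_line: "real_vs real_line"
proof -
  have "abelian_group real_line"
    by (rule abelian_groupI) (auto simp: real_line_def, metis add.left_inverse)
  then have "module real_ring real_line"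
    by (intro moduleI real_ring_cring) (auto simp: real_line_def real_ring_def algebra_simps)
  then show ?thesis by (auto simp: real_vs_def real_line_def extensional_def)
qed


section \<open>The usual tensor product\<close>

text \<open>
  The quotient of the free vector space on \<open>carrier V \<times> carrier W\<close>, realised by finitely supported
  functions, by the subspace generated by the relations of bilinearity.
\<close>

definition formal_sums :: "(real, 'a) module \<Rightarrow> (real, 'b) module \<Rightarrow> ('a \<times> 'b \<Rightarrow> real) set" where
  "formal_sums V W = {p. finite {x. p x \<noteq> 0} \<and> {x. p x \<noteq> 0} \<subseteq> carrier V \<times> carrier W}"

abbreviation formal_pair :: "'a \<Rightarrow> 'b \<Rightarrow> 'a \<times> 'b \<Rightarrow> real" where
  "formal_pair v w \<equiv> indicator {(v, w)}"

inductive_set bilin_rel :: "(real, 'a) module \<Rightarrow> (real, 'b) module \<Rightarrow> ('a \<times> 'b \<Rightarrow> real) set"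
  for V :: "(real, 'a) module" and W :: "(real, 'b) module" where
  zero: "(\<lambda>x. 0) \<in> bilin_rel V W"
| add: "p \<in> bilin_rel V W \<Longrightarrow> q \<in> bilin_rel V W \<Longrightarrow> (\<lambda>x. p x + q x) \<in> bilin_rel V W"
| scale: "p \<in> bilin_rel V W \<Longrightarrow> (\<lambda>x. a * p x) \<in> bilin_rel V W"
| add_left: "v \<in> carrier V \<Longrightarrow> v' \<in> carrier V \<Longrightarrow> w \<in> carrier W \<Longrightarrow>
    (\<lambda>x. formal_pair (v \<oplus>\<^bsub>V\<^esub> v') w x - formal_pair v w x - formal_pair v' w x) \<in> bilin_rel V W"
| add_right: "v \<in> carrier V \<Longrightarrow> w \<in> carrier W \<Longrightarrow> w' \<in> carrier W \<Longrightarrow>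
    (\<lambda>x. formal_pair v (w \<oplus>\<^bsub>W\<^esub> w') x - formal_pair v w x - formal_pair v w' x) \<in> bilin_rel V W"
| scale_left: "v \<in> carrier V \<Longrightarrow> w \<in> carrier W \<Longrightarrow>
    (\<lambda>x. formal_pair (a \<odot>\<^bsub>V\<^esub> v) w x - a * formal_pair v w x) \<in> bilin_rel V W"
| scale_right: "v \<in> carrier V \<Longrightarrow> w \<in> carrier W \<Longrightarrow>
    (\<lambda>x. formal_pair v (a \<odot>\<^bsub>W\<^esub> w) x - a * formal_pair v w x) \<in> bilin_rel V W"

definition tensor_class ::
  "(real, 'a) module \<Rightarrow> (real, 'b) module \<Rightarrow> ('a \<times> 'b \<Rightarrow> real) \<Rightarrow> ('a \<times> 'b \<Rightarrow> real) set" where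
  "tensor_class V W p = {q \<in> formal_sums V W. (\<lambda>x. q x - p x) \<in> bilin_rel V W}"

definition usual_tensor ::
  "(real, 'a) module \<Rightarrow> (real, 'b) module \<Rightarrow> (real, ('a \<times> 'b \<Rightarrow> real) set) module" where
  "usual_tensor V W = \<lparr>carrier = tensor_class V W ` formal_sums V W,
     mult = undefined, one = undefined,
     zero = tensor_class V W (\<lambda>x. 0),
     add = (\<lambda>A B. \<Union>p\<in>A. \<Union>q\<in>B. tensor_class V W (\<lambda>x. p x + q x)),
     smult = (\<lambda>a A. \<Union>p\<in>A. tensor_class V W (\<lambda>x. a * p x))\<rparr>"

definition usual_pure ::
  "(real, 'a) module \<Rightarrow> (real, 'b) module \<Rightarrow> 'a \<Rightarrow> 'b \<Rightarrow> ('a \<times> 'b \<Rightarrow> real) set" where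
  "usual_pure V W v w = tensor_class V W (formal_pair v w)"


section \<open>Vector spaces with a strict tensor product\<close>

definition pure_tensor ::
  "((real, 'a) module \<Rightarrow> (real, 'a) module \<Rightarrow> ('a \<times> 'a \<Rightarrow> real) set \<Rightarrow> 'a) \<Rightarrow>
    (real, 'a) module \<Rightarrow> (real, 'a) module \<Rightarrow> 'a \<Rightarrow> 'a \<Rightarrow> 'a" where
  "pure_tensor \<xi> V W v w = \<xi> V W (usual_pure V W v w)"

text \<open>
  A Schauenburg tensor product is a strict monoidal structure on \<open>Vect\<close> with unit object the real
  line, together with natural linear isomorphisms \<open>\<xi> V W\<close> from the usual tensor product that make
  the identity functor of \<open>Vect\<close>, with the identity as unit comparison, a monoidal functor.
  Naturality and coherence are equations between linear maps on (iterated) usual tensor products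
  and are stated on pure tensors.  The laws of a symmetry are not assumed: they follow from
  \<open>Braid_pure\<close>.
\<close>

locale schauenburg_Vect = strict_monoidal_category C
  for C :: "((real, real + 'a) module, (real + 'a) lin_map) smcat" +
  fixes \<xi> :: "(real, real + 'a) module \<Rightarrow> (real, real + 'a) module \<Rightarrow>
    ((real + 'a) \<times> (real + 'a) \<Rightarrow> real) set \<Rightarrow> real + 'a"
  assumes underlying_Vect: "cat.truncate C = Vect"
    and Unit_real_line: "Unit C = real_line"
    and \<xi>_linear: "V \<in> Obj C \<Longrightarrow> W \<in> Obj C \<Longrightarrow>
      \<xi> V W \<in> linear_maps (usual_tensor V W) (TensO C V W)"
    and \<xi>_bij: "V \<in> Obj C \<Longrightarrow> W \<in> Obj C \<Longrightarrow>
      bij_betw (\<xi> V W) (carrier (usual_tensor V W)) (carrier (TensO C V W))"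
    and \<xi>_natural: "f \<in> Hom C V V' \<Longrightarrow> g \<in> Hom C W W' \<Longrightarrow> v \<in> carrier V \<Longrightarrow> w \<in> carrier W \<Longrightarrow>
      lin_fun (TensM C f g) (pure_tensor \<xi> V W v w) = pure_tensor \<xi> V' W' (lin_fun f v) (lin_fun g w)"
    and \<xi>_assoc: "U \<in> Obj C \<Longrightarrow> V \<in> Obj C \<Longrightarrow> W \<in> Obj C \<Longrightarrow>
      u \<in> carrier U \<Longrightarrow> v \<in> carrier V \<Longrightarrow> w \<in> carrier W \<Longrightarrow>
      pure_tensor \<xi> (TensO C U V) W (pure_tensor \<xi> U V u v) w =
      pure_tensor \<xi> U (TensO C V W) u (pure_tensor \<xi> V W v w)"
    and \<xi>_Unit_left: "V \<in> Obj C \<Longrightarrow> v \<in> carrier V \<Longrightarrow>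
      pure_tensor \<xi> real_line V (Inl a) v = a \<odot>\<^bsub>V\<^esub> v"
    and \<xi>_Unit_right: "V \<in> Obj C \<Longrightarrow> v \<in> carrier V \<Longrightarrow>
      pure_tensor \<xi> V real_line v (Inl a) = a \<odot>\<^bsub>V\<^esub> v"
    and Braid_in_Hom: "V \<in> Obj C \<Longrightarrow> W \<in> Obj C \<Longrightarrow>
      Braid C V W \<in> Hom C (TensO C V W) (TensO C W V)"
    and Braid_pure: "V \<in> Obj C \<Longrightarrow> W \<in> Obj C \<Longrightarrow> v \<in> carrier V \<Longrightarrow> w \<in> carrier W \<Longrightarrow>
      lin_fun (Braid C V W) (pure_tensor \<xi> V W v w) = pure_tensor \<xi> W V w v"

lemma formal_sums_add: "p \<in> formal_sums V W \<Longrightarrow> q \<in> formal_sums V W \<Longrightarrow> (\<lambda>x. p x + q x) \<in> formal_sums V W"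
proof -
  assume "p \<in> formal_sums V W" "q \<in> formal_sums V W"
  moreover have "{x. p x + q x \<noteq> 0} \<subseteq> {x. p x \<noteq> 0} \<union> {x. q x \<noteq> 0}" by auto
  ultimately show ?thesis
    unfolding formal_sums_def mem_Collect_eq by (meson finite_Un finite_subset le_sup_iff order_trans)
qed

lemma formal_sums_scale: "p \<in> formal_sums V W \<Longrightarrow> (\<lambda>x. a * p x) \<in> formal_sums V W"
proof -
  assume "p \<in> formal_sums V W"
  moreover have "{x. a * p x \<noteq> 0} \<subseteq> {x. p x \<noteq> 0}" by auto
  ultimately show ?thesis
    unfolding formal_sums_def mem_Collect_eq by (meson finite_subset order_trans)
qed

lemma formal_sums_pair: "v \<in> carrier V \<Longrightarrow> w \<in> carrier W \<Longrightarrow> formal_pair v w \<in> formal_sums V W"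
  by (auto simp: formal_sums_def indicator_def)

lemma bilin_rel_diff: "p \<in> bilin_rel V W \<Longrightarrow> q \<in> bilin_rel V W \<Longrightarrow> (\<lambda>x. p x - q x) \<in> bilin_rel V W"
  using bilin_rel.add[OF _ bilin_rel.scale[of q V W "-1"], of p] by simp

lemma tensor_class_eqI:
  assumes "(\<lambda>x. p x - q x) \<in> bilin_rel V W"
  shows "tensor_class V W p = tensor_class V W q"
proof -
  have "(\<lambda>x. r x - q x) \<in> bilin_rel V W \<longleftrightarrow> (\<lambda>x. r x - p x) \<in> bilin_rel V W" for r
    using bilin_rel.add[OF _ assms, of "\<lambda>x. r x - p x"] bilin_rel_diff[OF _ assms, of "\<lambda>x. r x - q x"]
    by auto
  then show ?thesis by (simp add: tensor_class_def)
qed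

lemma tensor_class_self: "p \<in> formal_sums V W \<Longrightarrow> p \<in> tensor_class V W p"
  by (simp add: tensor_class_def bilin_rel.zero)

lemma usual_tensor_add:
  assumes "p \<in> formal_sums V W" "q \<in> formal_sums V W"
  shows "tensor_class V W p \<oplus>\<^bsub>usual_tensor V W\<^esub> tensor_class V W q = tensor_class V W (\<lambda>x. p x + q x)"
proof -
  have "tensor_class V W (\<lambda>x. p' x + q' x) = tensor_class V W (\<lambda>x. p x + q x)"
    if "p' \<in> tensor_class V W p" "q' \<in> tensor_class V W q" for p' q'
    using that bilin_rel.add[of "\<lambda>x. p' x - p x" V W "\<lambda>x. q' x - q x"]
    by (intro tensor_class_eqI) (simp add: tensor_class_def algebra_simps)
  then show ?thesis
    unfolding usual_tensor_def ring_record_simps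
    using tensor_class_self[OF assms(1)] tensor_class_self[OF assms(2)]
    by (intro SUP_eq_const) blast+
qed

lemma usual_tensor_smult:
  assumes "p \<in> formal_sums V W"
  shows "a \<odot>\<^bsub>usual_tensor V W\<^esub> tensor_class V W p = tensor_class V W (\<lambda>x. a * p x)"
proof -
  have "tensor_class V W (\<lambda>x. a * p' x) = tensor_class V W (\<lambda>x. a * p x)"
    if "p' \<in> tensor_class V W p" for p'
    using that bilin_rel.scale[of "\<lambda>x. p' x - p x" V W a]
    by (intro tensor_class_eqI) (simp add: tensor_class_def algebra_simps)
  then show ?thesis
    unfolding usual_tensor_def module.simps
    using tensor_class_self[OF assms] by (intro SUP_eq_const) blast+
qed

lemma usual_pure_carrier:
  "v \<in> carrier V \<Longrightarrow> w \<in> carrier W \<Longrightarrow> usual_pure V W v w \<in> carrier (usual_tensor V W)"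
  by (simp add: usual_pure_def usual_tensor_def formal_sums_pair)

lemma usual_pure_add_right:
  assumes "v \<in> carrier V" "w \<in> carrier W" "w' \<in> carrier W"
  shows "usual_pure V W v (w \<oplus>\<^bsub>W\<^esub> w') = usual_pure V W v w \<oplus>\<^bsub>usual_tensor V W\<^esub> usual_pure V W v w'"
proof -
  have "usual_pure V W v (w \<oplus>\<^bsub>W\<^esub> w') = tensor_class V W (\<lambda>x. formal_pair v w x + formal_pair v w' x)"
    unfolding usual_pure_def
    using bilin_rel.add_right[OF assms] by (intro tensor_class_eqI) (simp add: algebra_simps)
  with assms show ?thesis by (simp add: usual_pure_def usual_tensor_add formal_sums_pair)
qed

lemma usual_pure_smult_right:
  assumes "v \<in> carrier V" "w \<in> carrier W"
  shows "usual_pure V W v (a \<odot>\<^bsub>W\<^esub> w) = a \<odot>\<^bsub>usual_tensor V W\<^esub> usual_pure V W v w"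
proof -
  have "usual_pure V W v (a \<odot>\<^bsub>W\<^esub> w) = tensor_class V W (\<lambda>x. a * formal_pair v w x)"
    unfolding usual_pure_def
    using bilin_rel.scale_right[OF assms, of a] by (intro tensor_class_eqI)
  with assms show ?thesis by (simp add: usual_pure_def usual_tensor_smult formal_sums_pair)
qed

lemma usual_tensor_induct [consumes 3, case_names pure add smult]:
  assumes "real_vs V" "real_vs W" and A: "A \<in> carrier (usual_tensor V W)"
    and pure: "\<And>v w. v \<in> carrier V \<Longrightarrow> w \<in> carrier W \<Longrightarrow> P (usual_pure V W v w)"
    and add: "\<And>A B. A \<in> carrier (usual_tensor V W) \<Longrightarrow> B \<in> carrier (usual_tensor V W) \<Longrightarrow>
      P A \<Longrightarrow> P B \<Longrightarrow> P (A \<oplus>\<^bsub>usual_tensor V W\<^esub> B)"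
    and smult: "\<And>a A. A \<in> carrier (usual_tensor V W) \<Longrightarrow> P A \<Longrightarrow> P (a \<odot>\<^bsub>usual_tensor V W\<^esub> A)"
  shows "P A"
proof -
  interpret V: module real_ring V using assms(1) by (simp add: real_vs_def)
  interpret W: module real_ring W using assms(2) by (simp add: real_vs_def)
  have carr: "tensor_class V W p \<in> carrier (usual_tensor V W)" if "p \<in> formal_sums V W" for p
    using that by (simp add: usual_tensor_def)
  have "P (tensor_class V W p)" if "finite S" "{x. p x \<noteq> 0} = S" "S \<subseteq> carrier V \<times> carrier W" for p S
    using that
  proof (induction S arbitrary: p rule: finite_induct)
    case empty
    then have "p = (\<lambda>x. 0 * formal_pair \<zero>\<^bsub>V\<^esub> \<zero>\<^bsub>W\<^esub> x)" by auto
    then have "tensor_class V W p = 0 \<odot>\<^bsub>usual_tensor V W\<^esub> usual_pure V W \<zero>\<^bsub>V\<^esub> \<zero>\<^bsub>W\<^esub>"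
      by (simp add: usual_pure_def usual_tensor_smult formal_sums_pair)
    then show ?case by (simp add: smult pure usual_pure_carrier)
  next
    case (insert y S)
    obtain v w where y: "y = (v, w)" "v \<in> carrier V" "w \<in> carrier W" using insert.prems by auto
    define q where "q = p(y := 0)"
    have q: "{x. q x \<noteq> 0} = S" using insert.prems(1) insert.hyps(2) by (auto simp: q_def)
    then have qF: "q \<in> formal_sums V W" using insert by (auto simp: formal_sums_def)
    have "p = (\<lambda>x. q x + p y * formal_pair v w x)"
      by (auto simp: q_def y indicator_def fun_eq_iff)
    then have "tensor_class V W p =
        tensor_class V W q \<oplus>\<^bsub>usual_tensor V W\<^esub> (p y \<odot>\<^bsub>usual_tensor V W\<^esub> usual_pure V W v w)"
      using y qF by (simp add: usual_pure_def usual_tensor_smult usual_tensor_add formal_sums_pair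
          formal_sums_scale)
    moreover have "P (tensor_class V W q)" using insert.IH[OF q] insert.prems by auto
    moreover have "p y \<odot>\<^bsub>usual_tensor V W\<^esub> usual_pure V W v w \<in> carrier (usual_tensor V W)"
      using y by (simp add: usual_pure_def usual_tensor_smult formal_sums_pair formal_sums_scale carr)
    ultimately show ?case using y qF by (auto intro!: add smult pure carr usual_pure_carrier)
  qed
  with A show ?thesis by (auto simp: usual_tensor_def formal_sums_def)
qed

context schauenburg_Vect
begin

lemma C_simps:
  "Obj C = {V. real_vs V}"
  "Arr C = {Lin V f W | V f W. real_vs V \<and> real_vs W \<and> f \<in> linear_maps V W}"
  "Dom C = lin_dom" "Cod C = lin_cod" "Id C V = Lin V (\<lambda>x\<in>carrier V. x) V"
  "Comp C g f = Lin (lin_dom f) (compose (carrier (lin_dom f)) (lin_fun g) (lin_fun f)) (lin_cod g)"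
  using underlying_Vect by (cases C; simp add: Vect_def cat.defs)+

lemma C_Hom: "f \<in> Hom C V W \<longleftrightarrow>
    real_vs V \<and> real_vs W \<and> f = Lin V (lin_fun f) W \<and> lin_fun f \<in> linear_maps V W"
  by (cases f) (auto simp: Hom_def C_simps)

lemma pure_tensor_carrier:
  "real_vs V \<Longrightarrow> real_vs W \<Longrightarrow> v \<in> carrier V \<Longrightarrow> w \<in> carrier W \<Longrightarrow>
    pure_tensor \<xi> V W v w \<in> carrier (TensO C V W)"
  using \<xi>_linear[of V W] usual_pure_carrier[of v V w W]
  by (auto simp: pure_tensor_def linear_maps_def C_simps)

lemma TensO_induct [consumes 3, case_names pure add smult]:
  assumes V: "real_vs V" and W: "real_vs W" and x: "x \<in> carrier (TensO C V W)"
    and pure: "\<And>v w. v \<in> carrier V \<Longrightarrow> w \<in> carrier W \<Longrightarrow> P (pure_tensor \<xi> V W v w)"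
    and add: "\<And>x y. x \<in> carrier (TensO C V W) \<Longrightarrow> y \<in> carrier (TensO C V W) \<Longrightarrow>
      P x \<Longrightarrow> P y \<Longrightarrow> P (x \<oplus>\<^bsub>TensO C V W\<^esub> y)"
    and smult: "\<And>a x. x \<in> carrier (TensO C V W) \<Longrightarrow> P x \<Longrightarrow> P (a \<odot>\<^bsub>TensO C V W\<^esub> x)"
  shows "P x"
proof -
  have lin: "\<xi> V W \<in> linear_maps (usual_tensor V W) (TensO C V W)"
    using V W by (intro \<xi>_linear) (simp_all add: C_simps)
  obtain A where A: "A \<in> carrier (usual_tensor V W)" "x = \<xi> V W A"
    using \<xi>_bij[of V W] V W x by (auto simp: C_simps bij_betw_def)
  have "P (\<xi> V W A)" using V W A(1)
  proof (induction rule: usual_tensor_induct)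
    case (pure v w)
    then show ?case using assms(4) by (simp add: pure_tensor_def)
  next
    case (add A B)
    then show ?case using lin assms(5)[of "\<xi> V W A" "\<xi> V W B"] by (auto simp: linear_maps_def)
  next
    case (smult a A)
    then show ?case using lin assms(6)[of "\<xi> V W A" a] by (auto simp: linear_maps_def)
  qed
  with A show ?thesis by simp
qed

lemma Hom_eqI:
  assumes "f \<in> Hom C V W" "g \<in> Hom C V W" "\<And>x. x \<in> carrier V \<Longrightarrow> lin_fun f x = lin_fun g x"
  shows "f = g"
proof -
  have "lin_fun f = lin_fun g"
    by (rule extensionalityI[of _ "carrier V"])
      (use assms in \<open>auto simp: C_Hom linear_maps_def PiE_def\<close>)
  with assms(1,2) show ?thesis by (metis C_Hom)
qed

lemma Hom_TensO_eqI:
  assumes V: "real_vs V" and W: "real_vs W"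
    and f: "f \<in> Hom C (TensO C V W) Z" and g: "g \<in> Hom C (TensO C V W) Z"
    and eq: "\<And>v w. v \<in> carrier V \<Longrightarrow> w \<in> carrier W \<Longrightarrow>
      lin_fun f (pure_tensor \<xi> V W v w) = lin_fun g (pure_tensor \<xi> V W v w)"
  shows "f = g"
proof (rule Hom_eqI[OF f g])
  fix x assume "x \<in> carrier (TensO C V W)"
  with V W show "lin_fun f x = lin_fun g x"
    by (induction rule: TensO_induct) (use f g eq in \<open>auto simp: C_Hom linear_maps_def\<close>)
qed

lemma Hom_TensO3_eqI:
  assumes U: "real_vs U" and V: "real_vs V" and W: "real_vs W"
    and f: "f \<in> Hom C (TensO C U (TensO C V W)) Z" and g: "g \<in> Hom C (TensO C U (TensO C V W)) Z"
    and eq: "\<And>u v w. u \<in> carrier U \<Longrightarrow> v \<in> carrier V \<Longrightarrow> w \<in> carrier W \<Longrightarrow>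
      lin_fun f (pure_tensor \<xi> U (TensO C V W) u (pure_tensor \<xi> V W v w)) =
      lin_fun g (pure_tensor \<xi> U (TensO C V W) u (pure_tensor \<xi> V W v w))"
  shows "f = g"
proof -
  have VW: "real_vs (TensO C V W)" using TensO_Obj[of V W] V W by (simp add: C_simps)
  let ?T = "TensO C V W" and ?U = "usual_tensor U (TensO C V W)"
  have lin: "\<xi> U ?T \<in> linear_maps ?U (TensO C U ?T)"
    using U VW by (intro \<xi>_linear) (simp_all add: C_simps)
  show ?thesis
  proof (rule Hom_TensO_eqI[OF U VW f g])
    fix u t assume u: "u \<in> carrier U" and t: "t \<in> carrier ?T"
    show "lin_fun f (pure_tensor \<xi> U ?T u t) = lin_fun g (pure_tensor \<xi> U ?T u t)"
      using V W t
    proof (induction rule: TensO_induct)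
      case (pure v w)
      then show ?case using eq u by simp
    next
      case (add x y)
      have "pure_tensor \<xi> U ?T u (x \<oplus>\<^bsub>?T\<^esub> y) =
          pure_tensor \<xi> U ?T u x \<oplus>\<^bsub>TensO C U ?T\<^esub> pure_tensor \<xi> U ?T u y"
        using lin u add(1,2)
        by (simp add: pure_tensor_def usual_pure_add_right usual_pure_carrier linear_maps_def)
      then show ?case using add f g u pure_tensor_carrier[OF U VW u]
        by (simp add: C_Hom linear_maps_def)
    next
      case (smult a x)
      have "pure_tensor \<xi> U ?T u (a \<odot>\<^bsub>?T\<^esub> x) = a \<odot>\<^bsub>TensO C U ?T\<^esub> pure_tensor \<xi> U ?T u x"
        using lin u smult(1)
        by (simp add: pure_tensor_def usual_pure_smult_right usual_pure_carrier linear_maps_def)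
      then show ?case using smult f g u pure_tensor_carrier[OF U VW u]
        by (simp add: C_Hom linear_maps_def)
    qed
  qed
qed

lemma lin_fun_Comp:
  "f \<in> Hom C U V \<Longrightarrow> g \<in> Hom C V W \<Longrightarrow> x \<in> carrier U \<Longrightarrow> lin_fun (Comp C g f) x = lin_fun g (lin_fun f x)"
  by (auto simp: C_simps C_Hom compose_def Hom_def)

lemma lin_fun_carrier: "f \<in> Hom C V W \<Longrightarrow> x \<in> carrier V \<Longrightarrow> lin_fun f x \<in> carrier W"
  by (auto simp: C_Hom linear_maps_def)

lemma lin_fun_Id: "x \<in> carrier V \<Longrightarrow> lin_fun (Id C V) x = x"
  by (simp add: C_simps)

end

sublocale schauenburg_Vect \<subseteq> symmetric_strict_monoidal_category C
proof
  note [simp] = C_simps(1) lin_fun_Comp lin_fun_Id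
  show "Braid C X Y \<in> Hom C (TensO C X Y) (TensO C Y X)" if "X \<in> Obj C" "Y \<in> Obj C" for X Y
    using that by (rule Braid_in_Hom)
  show "Comp C (Braid C Y Y') (TensM C f f') = Comp C (TensM C f' f) (Braid C X X')"
    if f: "f \<in> Hom C X Y" and f': "f' \<in> Hom C X' Y'" for f f' X Y X' Y'
  proof -
    have O: "real_vs X" "real_vs Y" "real_vs X'" "real_vs Y'" using f f' by (simp_all add: C_Hom)
    note B = Braid_in_Hom[of Y Y'] Braid_in_Hom[of X X'] and T = TensM_Hom[OF f f'] TensM_Hom[OF f' f]
    show ?thesis
    proof (rule Hom_TensO_eqI[OF O(1,3)])
      show "Comp C (Braid C Y Y') (TensM C f f') \<in> Hom C (TensO C X X') (TensO C Y' Y)"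
        using B T O by (auto intro: Comp_Hom)
      show "Comp C (TensM C f' f) (Braid C X X') \<in> Hom C (TensO C X X') (TensO C Y' Y)"
        using B T O by (auto intro: Comp_Hom)
      fix v w assume vw: "v \<in> carrier X" "w \<in> carrier X'"
      then have p: "pure_tensor \<xi> X X' v w \<in> carrier (TensO C X X')" using O pure_tensor_carrier by simp
      show "lin_fun (Comp C (Braid C Y Y') (TensM C f f')) (pure_tensor \<xi> X X' v w) =
          lin_fun (Comp C (TensM C f' f) (Braid C X X')) (pure_tensor \<xi> X X' v w)"
        using lin_fun_Comp[OF T(1) B(1) p] lin_fun_Comp[OF B(2) T(2) p] O vw
          \<xi>_natural[OF f f' vw] \<xi>_natural[OF f' f vw(2,1)] lin_fun_carrier[OF f] lin_fun_carrier[OF f']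
        by (simp add: Braid_pure)
    qed
  qed
  show "Braid C X (TensO C Y Z) =
      Comp C (TensM C (Id C Y) (Braid C X Z)) (TensM C (Braid C X Y) (Id C Z))"
    if O: "X \<in> Obj C" "Y \<in> Obj C" "Z \<in> Obj C" for X Y Z
  proof -
    have O': "real_vs X" "real_vs Y" "real_vs Z" using O by simp_all
    have a: "TensO C (TensO C X Y) Z = TensO C X (TensO C Y Z)"
        "TensO C Y (TensO C X Z) = TensO C (TensO C Y X) Z"
        "TensO C (TensO C Y Z) X = TensO C Y (TensO C Z X)"
      using O by (simp_all only: TensO_assoc)
    have 1: "TensM C (Braid C X Y) (Id C Z) \<in> Hom C (TensO C X (TensO C Y Z)) (TensO C (TensO C Y X) Z)"
      using TensM_Hom[OF Braid_in_Hom[OF O(1,2)] Id_Hom[OF O(3)]] a by simp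
    have 2: "TensM C (Id C Y) (Braid C X Z) \<in> Hom C (TensO C (TensO C Y X) Z) (TensO C (TensO C Y Z) X)"
      using TensM_Hom[OF Id_Hom[OF O(2)] Braid_in_Hom[OF O(1,3)]] a by simp
    show ?thesis
    proof (rule Hom_TensO3_eqI[OF O'])
      show "Braid C X (TensO C Y Z) \<in> Hom C (TensO C X (TensO C Y Z)) (TensO C (TensO C Y Z) X)"
        by (intro Braid_in_Hom TensO_Obj O)
      show "Comp C (TensM C (Id C Y) (Braid C X Z)) (TensM C (Braid C X Y) (Id C Z)) \<in>
          Hom C (TensO C X (TensO C Y Z)) (TensO C (TensO C Y Z) X)"
        by (rule Comp_Hom[OF 1 2])
      fix x y z assume e: "x \<in> carrier X" "y \<in> carrier Y" "z \<in> carrier Z"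
      note pc = pure_tensor_carrier[OF O'(1,2) e(1,2)] pure_tensor_carrier[OF O'(2,3) e(2,3)]
        pure_tensor_carrier[OF O'(1,3) e(1,3)]
      have YZ: "TensO C Y Z \<in> Obj C" "real_vs (TensO C Y Z)" using TensO_Obj[OF O(2,3)] by simp_all
      let ?p = "pure_tensor \<xi> X (TensO C Y Z) x (pure_tensor \<xi> Y Z y z)"
      have p: "?p \<in> carrier (TensO C X (TensO C Y Z))"
        using pure_tensor_carrier[OF O'(1) YZ(2) e(1) pc(2)] .
      have "lin_fun (TensM C (Braid C X Y) (Id C Z)) ?p =
          pure_tensor \<xi> (TensO C Y X) Z (pure_tensor \<xi> Y X y x) z"
        using \<xi>_natural[OF Braid_in_Hom[OF O(1,2)] Id_Hom[OF O(3)] pc(1) e(3)] e O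
        by (simp add: \<xi>_assoc[symmetric] Braid_pure)
      also have "\<dots> = pure_tensor \<xi> Y (TensO C X Z) y (pure_tensor \<xi> X Z x z)"
        using e O by (simp add: \<xi>_assoc)
      finally have "lin_fun (Comp C (TensM C (Id C Y) (Braid C X Z)) (TensM C (Braid C X Y) (Id C Z))) ?p =
          pure_tensor \<xi> Y (TensO C Z X) y (pure_tensor \<xi> Z X z x)"
        using \<xi>_natural[OF Id_Hom[OF O(2)] Braid_in_Hom[OF O(1,3)] e(2) pc(3)] e O
          lin_fun_Comp[OF 1 2 p] by (simp add: Braid_pure)
      also have "\<dots> = lin_fun (Braid C X (TensO C Y Z)) ?p"
        using Braid_pure[OF O(1) YZ(1) e(1) pc(2)] e O by (simp add: \<xi>_assoc)
      finally show "lin_fun (Braid C X (TensO C Y Z)) ?p =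
          lin_fun (Comp C (TensM C (Id C Y) (Braid C X Z)) (TensM C (Braid C X Y) (Id C Z))) ?p" ..
    qed
  qed
  show "Braid C X (Unit C) = Id C X" if O: "X \<in> Obj C" for X
  proof (rule Hom_TensO_eqI[of X real_line])
    have R: "real_line \<in> Obj C" using Unit_Obj Unit_real_line by simp
    then show "real_vs (real_line :: (real, real + 'a) module)" by simp
    show "real_vs X" using O by simp
    have XR: "TensO C X real_line = X" "TensO C real_line X = X"
      using TensO_Unit_left[OF O] TensO_Unit_right[OF O] Unit_real_line by simp_all
    show "Braid C X (Unit C) \<in> Hom C (TensO C X real_line) X"
      using Braid_in_Hom[OF O R] XR by (simp add: Unit_real_line)
    show "Id C X \<in> Hom C (TensO C X real_line) X" using Id_Hom[OF O] XR by simp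
    fix v w :: "real + 'a"
    assume v: "v \<in> carrier X" and w: "w \<in> carrier real_line"
    then obtain a where a: "w = Inl a" by (auto simp: real_line_def)
    have "pure_tensor \<xi> X real_line v w \<in> carrier X"
      using pure_tensor_carrier[of X real_line v w] O R v w XR by simp
    then show "lin_fun (Braid C X (Unit C)) (pure_tensor \<xi> X real_line v w) =
        lin_fun (Id C X) (pure_tensor \<xi> X real_line v w)"
      using Braid_pure[OF O R v w] \<xi>_Unit_left[OF O v] \<xi>_Unit_right[OF O v] a
      by (simp add: Unit_real_line)
  qed
  show "Comp C (Braid C Y X) (Braid C X Y) = Id C (TensO C X Y)"
    if O: "X \<in> Obj C" "Y \<in> Obj C" for X Y
  proof (rule Hom_TensO_eqI[of X Y])
    note B = Braid_in_Hom[OF O] Braid_in_Hom[OF O(2,1)]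
    show "real_vs X" "real_vs Y" using O by simp_all
    show "Comp C (Braid C Y X) (Braid C X Y) \<in> Hom C (TensO C X Y) (TensO C X Y)"
      by (rule Comp_Hom[OF B])
    show "Id C (TensO C X Y) \<in> Hom C (TensO C X Y) (TensO C X Y)"
      by (intro Id_Hom TensO_Obj O)
    fix v w assume "v \<in> carrier X" "w \<in> carrier Y"
    then show "lin_fun (Comp C (Braid C Y X) (Braid C X Y)) (pure_tensor \<xi> X Y v w) =
        lin_fun (Id C (TensO C X Y)) (pure_tensor \<xi> X Y v w)"
      using O lin_fun_Comp[OF B] pure_tensor_carrier[of X Y v w] by (simp add: Braid_pure)
  qed
qed


definition duality_structure :: "('o, 'm, 'x) smcat_scheme \<Rightarrow> 'o \<Rightarrow> 'm \<times> 'm \<Rightarrow> bool" where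
  "duality_structure C V = (\<lambda>(i, e).
     i \<in> Hom C (Unit C) (TensO C V V) \<and> Comp C (Braid C V V) i = i \<and>
     e \<in> Hom C (TensO C V V) (Unit C) \<and> Comp C e (Braid C V V) = e \<and>
     Comp C (TensM C e (Id C V)) (TensM C (Id C V) i) = Id C V)"

end

theory Submission
  imports Defs
begin

text \<open>
  The chromatic Brauer category is the free symmetric strict monoidal category on self-dual objects
  \<open>(k)\<close> with symmetric unit and counit.  The proof verifies this universal property for an arbitrary
  symmetric strict monoidal category \<open>C\<close> and arbitrary objects \<open>V k\<close> with duality structures; the
  vector spaces with their Schauenburg tensor product are one such \<open>C\<close>.

  Existence.  Objects are sent to iterated tensor products.  The unit of
  \<open>(k\<^sub>1) \<otimes> \<dots> \<otimes> (k\<^sub>m)\<close> is sent to the arrow obtained by nesting the given units, the innermost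
  one being that of the last letter, and the counit to the nested given counits, here with the first
  letter innermost; then every formal expression has a value in \<open>C\<close>, and it remains to see that the
  defining relations hold there.  The relations of symmetric strict monoidal categories are axioms
  of \<open>C\<close>.  Three points need an argument.  A duality structure satisfies one zig-zag equation by
  definition; the other one follows by turning the picture around with the braiding and using the
  symmetry of the copairing and of the pairing (\<open>dual_pair_duality_structure\<close>).  Nesting dual pairs preserves both zig-zag equations
  (\<open>dual_pair_tensor\<close>).  Finally, applying the braiding to a nested unit reverses the nesting
  and braids the two layers separately (\<open>braid_unit_tensor\<close>); since the units of the letters are
  symmetric, this gives the relation \<open>Unit_Braid\<close> by induction.

  Uniqueness.  A functor is determined by its values on the generators.  Objects, identities and
  braidings are forced, and the relations \<open>Unit_Unit\<close> and
  \<open>Unit_Tens\<close> force the units.  No relation expresses the counit of a tensor product, but the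
  zig-zag equations are preserved by the functor, and a counit is determined by the unit of the same
  dual pair (\<open>dual_pair_counit_unique\<close>).
\<close>


section \<open>Calculating in strict monoidal categories\<close>

context strict_monoidal_category
begin

text \<open>
  Homsets are traded for the three separate conditions \<open>f \<in> Arr C\<close>, \<open>Dom C f = X\<close> and
  \<open>Cod C f = Y\<close>, because the simplifier can then discharge all typing conditions by itself:
  objects are normalised to right-nested products without unit factors, and so are composites and
  tensor products of arrows.
\<close>

abbreviation comp (infixr \<open>\<cdot>\<close> 55) where "g \<cdot> f \<equiv> Comp C g f"
abbreviation tensM (infixr \<open>\<boxtimes>\<close> 60) where "f \<boxtimes> g \<equiv> TensM C f g"
abbreviation tensO (infixr \<open>\<diamondop>\<close> 60) where "X \<diamondop> Y \<equiv> TensO C X Y"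
abbreviation ident (\<open>\<I>\<close>) where "\<I> \<equiv> Id C"
abbreviation unit_obj (\<open>\<U>\<close>) where "\<U> \<equiv> Unit C"

lemma Hom_iff: "f \<in> Hom C X Y \<longleftrightarrow> f \<in> Arr C \<and> Dom C f = X \<and> Cod C f = Y"
  by (simp add: Hom_def)

lemmas obj_simps [simp] =
  Unit_Obj TensO_Obj TensO_assoc TensO_Unit_left TensO_Unit_right Dom_Obj Cod_Obj

lemma Id_typing [simp]:
  "X \<in> Obj C \<Longrightarrow> \<I> X \<in> Arr C" "X \<in> Obj C \<Longrightarrow> Dom C (\<I> X) = X" "X \<in> Obj C \<Longrightarrow> Cod C (\<I> X) = X"
  using Id_Hom by (auto simp: Hom_iff)

lemma Comp_typing [simp]:
  assumes "f \<in> Arr C" "g \<in> Arr C" "Dom C g = Cod C f"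
  shows "g \<cdot> f \<in> Arr C" "Dom C (g \<cdot> f) = Dom C f" "Cod C (g \<cdot> f) = Cod C g"
  using Comp_Hom[of f "Dom C f" "Cod C f" g "Cod C g"] assms by (auto simp: Hom_iff)

lemma TensM_typing [simp]:
  assumes "f \<in> Arr C" "g \<in> Arr C"
  shows "f \<boxtimes> g \<in> Arr C" "Dom C (f \<boxtimes> g) = Dom C f \<diamondop> Dom C g" "Cod C (f \<boxtimes> g) = Cod C f \<diamondop> Cod C g"
  using TensM_Hom[of f "Dom C f" "Cod C f" g "Dom C g" "Cod C g"] assms by (auto simp: Hom_iff)

lemma Comp_Id [simp]:
  "f \<in> Arr C \<Longrightarrow> Cod C f = Y \<Longrightarrow> \<I> Y \<cdot> f = f"
  "f \<in> Arr C \<Longrightarrow> Dom C f = X \<Longrightarrow> f \<cdot> \<I> X = f"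
  using Comp_Id_left Comp_Id_right by (auto simp: Hom_iff)

lemmas tensM_simps [simp] = TensM_assoc TensM_Unit_left TensM_Unit_right

lemma Comp_assoc_Arr [simp]:
  "f \<in> Arr C \<Longrightarrow> g \<in> Arr C \<Longrightarrow> h \<in> Arr C \<Longrightarrow> Dom C g = Cod C f \<Longrightarrow> Dom C h = Cod C g \<Longrightarrow>
     (h \<cdot> g) \<cdot> f = h \<cdot> g \<cdot> f"
  using Comp_assoc by (auto simp: Hom_iff)

lemma interchange:
  assumes "f \<in> Arr C" "g \<in> Arr C" "f' \<in> Arr C" "g' \<in> Arr C" "Dom C g = Cod C f" "Dom C g' = Cod C f'"
  shows "(g \<boxtimes> g') \<cdot> (f \<boxtimes> f') = (g \<cdot> f) \<boxtimes> (g' \<cdot> f')"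
  using TensM_Comp[of f "Dom C f" "Cod C f" g "Cod C g" f' "Dom C f'" "Cod C f'" g' "Cod C g'"] assms
  by (simp add: Hom_iff)

lemma interchange_assoc:
  assumes "f \<in> Arr C" "g \<in> Arr C" "f' \<in> Arr C" "g' \<in> Arr C" "Dom C g = Cod C f" "Dom C g' = Cod C f'"
    and "h \<in> Arr C" "Cod C h = Dom C f \<diamondop> Dom C f'"
  shows "(g \<boxtimes> g') \<cdot> (f \<boxtimes> f') \<cdot> h = ((g \<cdot> f) \<boxtimes> (g' \<cdot> f')) \<cdot> h"
  using assms interchange[OF assms(1-6)] by (simp flip: Comp_assoc_Arr)

lemma whisker_right:
  "f \<in> Arr C \<Longrightarrow> g \<in> Arr C \<Longrightarrow> Dom C g = Cod C f \<Longrightarrow> Z \<in> Obj C \<Longrightarrow>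
     (g \<cdot> f) \<boxtimes> \<I> Z = (g \<boxtimes> \<I> Z) \<cdot> (f \<boxtimes> \<I> Z)"
  by (simp add: interchange)

lemma whisker_left:
  "f \<in> Arr C \<Longrightarrow> g \<in> Arr C \<Longrightarrow> Dom C g = Cod C f \<Longrightarrow> Z \<in> Obj C \<Longrightarrow>
     \<I> Z \<boxtimes> (g \<cdot> f) = (\<I> Z \<boxtimes> g) \<cdot> (\<I> Z \<boxtimes> f)"
  by (simp add: interchange)


section \<open>Dual pairs\<close>

definition dual_pair :: "'o \<Rightarrow> 'o \<Rightarrow> 'm \<Rightarrow> 'm \<Rightarrow> bool" where
  "dual_pair X X' i e \<longleftrightarrow> X \<in> Obj C \<and> X' \<in> Obj C \<and> i \<in> Hom C \<U> (X \<diamondop> X') \<and> e \<in> Hom C (X' \<diamondop> X) \<U> \<and>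
     (e \<boxtimes> \<I> X') \<cdot> (\<I> X' \<boxtimes> i) = \<I> X' \<and> (\<I> X \<boxtimes> e) \<cdot> (i \<boxtimes> \<I> X) = \<I> X"

lemma dual_pair_unit: "dual_pair \<U> \<U> (\<I> \<U>) (\<I> \<U>)"
  by (simp add: dual_pair_def Hom_iff)

text \<open>
  In either zig-zag of the nested pair the inner unit \<open>j\<close> and the outer counit \<open>e\<close> sit at disjoint
  places and can change their order.  After this exchange the composite is a zig-zag for one pair
  followed by a zig-zag for the other.
\<close>

lemma dual_pair_tensor:
  assumes X: "dual_pair X X' i e" and Y: "dual_pair Y Y' j d"
  shows "dual_pair (X \<diamondop> Y) (Y' \<diamondop> X') ((\<I> X \<boxtimes> j \<boxtimes> \<I> X') \<cdot> i) (d \<cdot> (\<I> Y' \<boxtimes> e \<boxtimes> \<I> Y))"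
proof -
  have [simp]: "X \<in> Obj C" "X' \<in> Obj C" "Y \<in> Obj C" "Y' \<in> Obj C"
    "i \<in> Arr C" "Dom C i = \<U>" "Cod C i = X \<diamondop> X'" "e \<in> Arr C" "Dom C e = X' \<diamondop> X" "Cod C e = \<U>"
    "j \<in> Arr C" "Dom C j = \<U>" "Cod C j = Y \<diamondop> Y'" "d \<in> Arr C" "Dom C d = Y' \<diamondop> Y" "Cod C d = \<U>"
    using assms by (simp_all add: dual_pair_def Hom_iff)
  have zX: "(e \<boxtimes> \<I> X') \<cdot> (\<I> X' \<boxtimes> i) = \<I> X'" "(\<I> X \<boxtimes> e) \<cdot> (i \<boxtimes> \<I> X) = \<I> X"
    and zY: "(d \<boxtimes> \<I> Y') \<cdot> (\<I> Y' \<boxtimes> j) = \<I> Y'" "(\<I> Y \<boxtimes> d) \<cdot> (j \<boxtimes> \<I> Y) = \<I> Y"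
    using assms by (simp_all add: dual_pair_def)
  have slide1: "(e \<boxtimes> \<I> (Y \<diamondop> Y')) \<cdot> (\<I> (X' \<diamondop> X) \<boxtimes> j) = j \<cdot> e"
    using interchange[of e "\<I> \<U>" "\<I> \<U>" j] by (simp add: interchange)
  have slide2: "(\<I> (Y \<diamondop> Y') \<boxtimes> e) \<cdot> (j \<boxtimes> \<I> (X' \<diamondop> X)) = j \<cdot> e"
    using interchange[of "\<I> \<U>" j e "\<I> \<U>"] by (simp add: interchange)
  \<comment> \<open>In each of the following chains the two middle factors are isolated, exchanged by means of
    \<open>slide1\<close> or \<open>slide2\<close>, and absorbed into the two zig-zags.\<close>
  let ?i = "(\<I> X \<boxtimes> j \<boxtimes> \<I> X') \<cdot> i" and ?e = "d \<cdot> (\<I> Y' \<boxtimes> e \<boxtimes> \<I> Y)"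
  have "(?e \<boxtimes> \<I> (Y' \<diamondop> X')) \<cdot> (\<I> (Y' \<diamondop> X') \<boxtimes> ?i)
      = (d \<boxtimes> \<I> (Y' \<diamondop> X')) \<cdot> (((\<I> Y' \<boxtimes> e \<boxtimes> \<I> Y) \<boxtimes> \<I> (Y' \<diamondop> X')) \<cdot>
         (\<I> (Y' \<diamondop> X') \<boxtimes> (\<I> X \<boxtimes> j \<boxtimes> \<I> X'))) \<cdot> (\<I> (Y' \<diamondop> X') \<boxtimes> i)"
    by (subst whisker_left whisker_right; simp)+
  also have "((\<I> Y' \<boxtimes> e \<boxtimes> \<I> Y) \<boxtimes> \<I> (Y' \<diamondop> X')) \<cdot> (\<I> (Y' \<diamondop> X') \<boxtimes> (\<I> X \<boxtimes> j \<boxtimes> \<I> X'))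
     = (\<I> Y' \<boxtimes> (e \<boxtimes> \<I> (Y \<diamondop> Y')) \<boxtimes> \<I> X') \<cdot> (\<I> Y' \<boxtimes> (\<I> (X' \<diamondop> X) \<boxtimes> j) \<boxtimes> \<I> X')"
    by (simp flip: TensM_Id)
  also have "\<dots> = \<I> Y' \<boxtimes> (j \<cdot> e) \<boxtimes> \<I> X'"
    by (simp add: interchange slide1 del: TensM_assoc)
  also have "\<dots> = (\<I> Y' \<boxtimes> j \<boxtimes> \<I> X') \<cdot> (\<I> Y' \<boxtimes> e \<boxtimes> \<I> X')"
    by (simp add: interchange)
  also have "(d \<boxtimes> \<I> (Y' \<diamondop> X')) \<cdot> \<dots> \<cdot> (\<I> (Y' \<diamondop> X') \<boxtimes> i)
     = (((d \<boxtimes> \<I> Y') \<cdot> (\<I> Y' \<boxtimes> j)) \<boxtimes> \<I> X') \<cdot> (\<I> Y' \<boxtimes> ((e \<boxtimes> \<I> X') \<cdot> (\<I> X' \<boxtimes> i)))"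
    by (subst whisker_left whisker_right; simp flip: TensM_Id)+
  also have "\<dots> = \<I> (Y' \<diamondop> X')"
    by (simp add: zX zY TensM_Id)
  finally have 1: "(?e \<boxtimes> \<I> (Y' \<diamondop> X')) \<cdot> (\<I> (Y' \<diamondop> X') \<boxtimes> ?i) = \<I> (Y' \<diamondop> X')" .
  have "(\<I> (X \<diamondop> Y) \<boxtimes> ?e) \<cdot> (?i \<boxtimes> \<I> (X \<diamondop> Y))
      = (\<I> (X \<diamondop> Y) \<boxtimes> d) \<cdot> ((\<I> (X \<diamondop> Y) \<boxtimes> (\<I> Y' \<boxtimes> e \<boxtimes> \<I> Y)) \<cdot>
         ((\<I> X \<boxtimes> j \<boxtimes> \<I> X') \<boxtimes> \<I> (X \<diamondop> Y))) \<cdot> (i \<boxtimes> \<I> (X \<diamondop> Y))"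
    by (subst whisker_left whisker_right; simp)+
  also have "(\<I> (X \<diamondop> Y) \<boxtimes> (\<I> Y' \<boxtimes> e \<boxtimes> \<I> Y)) \<cdot> ((\<I> X \<boxtimes> j \<boxtimes> \<I> X') \<boxtimes> \<I> (X \<diamondop> Y))
     = (\<I> X \<boxtimes> (\<I> (Y \<diamondop> Y') \<boxtimes> e) \<boxtimes> \<I> Y) \<cdot> (\<I> X \<boxtimes> (j \<boxtimes> \<I> (X' \<diamondop> X)) \<boxtimes> \<I> Y)"
    by (simp flip: TensM_Id)
  also have "\<dots> = \<I> X \<boxtimes> (j \<cdot> e) \<boxtimes> \<I> Y"
    by (simp add: interchange slide2 del: TensM_assoc)
  also have "\<dots> = (\<I> X \<boxtimes> j \<boxtimes> \<I> Y) \<cdot> (\<I> X \<boxtimes> e \<boxtimes> \<I> Y)"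
    by (simp add: interchange)
  also have "(\<I> (X \<diamondop> Y) \<boxtimes> d) \<cdot> \<dots> \<cdot> (i \<boxtimes> \<I> (X \<diamondop> Y))
     = (\<I> X \<boxtimes> ((\<I> Y \<boxtimes> d) \<cdot> (j \<boxtimes> \<I> Y))) \<cdot> (((\<I> X \<boxtimes> e) \<cdot> (i \<boxtimes> \<I> X)) \<boxtimes> \<I> Y)"
    by (subst whisker_left whisker_right; simp flip: TensM_Id)+
  also have "\<dots> = \<I> (X \<diamondop> Y)"
    by (simp add: zX zY TensM_Id)
  finally have 2: "(\<I> (X \<diamondop> Y) \<boxtimes> ?e) \<cdot> (?i \<boxtimes> \<I> (X \<diamondop> Y)) = \<I> (X \<diamondop> Y)" .
  show ?thesis
    unfolding dual_pair_def using 1 2 by (simp add: Hom_iff)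
qed

text \<open>
  Insert the zig-zag made of \<open>i\<close> and \<open>e\<close> into the second leg of \<open>e'\<close>; the same diagram, read
  differently, is \<open>e\<close> with the zig-zag made of \<open>e'\<close> and \<open>i\<close> inserted into its first leg.
\<close>

lemma dual_pair_counit_unique:
  assumes "dual_pair X X' i e" "dual_pair X X' i e'"
  shows "e' = e"
proof -
  have [simp]: "X \<in> Obj C" "X' \<in> Obj C"
    "i \<in> Arr C" "Dom C i = \<U>" "Cod C i = X \<diamondop> X'" "e \<in> Arr C" "Dom C e = X' \<diamondop> X" "Cod C e = \<U>"
    "e' \<in> Arr C" "Dom C e' = X' \<diamondop> X" "Cod C e' = \<U>"
    and z: "(\<I> X \<boxtimes> e) \<cdot> (i \<boxtimes> \<I> X) = \<I> X" "(e' \<boxtimes> \<I> X') \<cdot> (\<I> X' \<boxtimes> i) = \<I> X'"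
    using assms by (simp_all add: dual_pair_def Hom_iff)
  have "e' = e' \<cdot> (\<I> X' \<boxtimes> ((\<I> X \<boxtimes> e) \<cdot> (i \<boxtimes> \<I> X)))"
    by (simp add: z TensM_Id)
  also have "\<dots> = (e' \<cdot> (\<I> (X' \<diamondop> X) \<boxtimes> e)) \<cdot> (\<I> X' \<boxtimes> i \<boxtimes> \<I> X)"
    by (subst whisker_left; simp flip: TensM_Id)
  also have "e' \<cdot> (\<I> (X' \<diamondop> X) \<boxtimes> e) = e' \<boxtimes> e"
    using interchange[of "\<I> (X' \<diamondop> X)" e' e "\<I> \<U>"] by simp
  also have "\<dots> = e \<cdot> (e' \<boxtimes> \<I> (X' \<diamondop> X))"
    using interchange[of e' "\<I> \<U>" "\<I> (X' \<diamondop> X)" e] by simp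
  also have "\<dots> \<cdot> (\<I> X' \<boxtimes> i \<boxtimes> \<I> X) = e \<cdot> (((e' \<boxtimes> \<I> X') \<cdot> (\<I> X' \<boxtimes> i)) \<boxtimes> \<I> X)"
    by (subst whisker_right; simp flip: TensM_Id)
  also have "\<dots> = e"
    by (simp add: z TensM_Id)
  finally show ?thesis .
qed

end


section \<open>Duality and the symmetry\<close>

context symmetric_strict_monoidal_category
begin

abbreviation braid (\<open>\<B>\<close>) where "\<B> \<equiv> Braid C"

lemma Braid_typing [simp]:
  assumes "X \<in> Obj C" "Y \<in> Obj C"
  shows "\<B> X Y \<in> Arr C" "Dom C (\<B> X Y) = X \<diamondop> Y" "Cod C (\<B> X Y) = Y \<diamondop> X"
  using Braid_Hom[OF assms] by (auto simp: Hom_iff)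

lemma braid_natural:
  "f \<in> Arr C \<Longrightarrow> g \<in> Arr C \<Longrightarrow>
    \<B> (Cod C f) (Cod C g) \<cdot> (f \<boxtimes> g) = (g \<boxtimes> f) \<cdot> \<B> (Dom C f) (Dom C g)"
  using Braid_natural[of f "Dom C f" "Cod C f" g "Dom C g" "Cod C g"] by (simp add: Hom_iff)

lemma Braid_cancel:
  "X \<in> Obj C \<Longrightarrow> Y \<in> Obj C \<Longrightarrow> f \<in> Arr C \<Longrightarrow> Cod C f = X \<diamondop> Y \<Longrightarrow> \<B> Y X \<cdot> \<B> X Y \<cdot> f = f"
  by (simp add: Braid_Braid flip: Comp_assoc_Arr)

text \<open>
  The hexagon for the other argument: the right-hand side and \<open>\<B> (X \<diamondop> Y) Z\<close> are both inverse to
  \<open>\<B> Z (X \<diamondop> Y)\<close>.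
\<close>

lemma Braid_TensO_left:
  assumes [simp]: "X \<in> Obj C" "Y \<in> Obj C" "Z \<in> Obj C"
  shows "\<B> (X \<diamondop> Y) Z = (\<B> X Z \<boxtimes> \<I> Y) \<cdot> (\<I> X \<boxtimes> \<B> Y Z)"
proof -
  let ?r = "(\<B> X Z \<boxtimes> \<I> Y) \<cdot> (\<I> X \<boxtimes> \<B> Y Z)"
  have "\<B> Z (X \<diamondop> Y) \<cdot> ?r = (\<I> X \<boxtimes> \<B> Z Y) \<cdot> ((\<B> Z X \<cdot> \<B> X Z) \<boxtimes> \<I> Y) \<cdot> (\<I> X \<boxtimes> \<B> Y Z)"
    by (simp add: Braid_TensO interchange_assoc)
  also have "\<dots> = \<I> (X \<diamondop> Y \<diamondop> Z)"
    by (simp add: Braid_Braid TensM_Id interchange)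
  finally have "\<B> (X \<diamondop> Y) Z \<cdot> \<B> Z (X \<diamondop> Y) \<cdot> ?r = \<B> (X \<diamondop> Y) Z"
    by simp
  then show ?thesis
    using Braid_cancel[of Z "X \<diamondop> Y" ?r] by simp
qed

lemma braid_counit_natural:
  assumes "e \<in> Hom C W \<U>" and [simp]: "X \<in> Obj C"
  shows "(e \<boxtimes> \<I> X) \<cdot> \<B> X W = \<I> X \<boxtimes> e"
  using assms braid_natural[of "\<I> X" e] by (simp add: Hom_iff Braid_Unit)

lemma braid_unit_natural:
  assumes "i \<in> Hom C \<U> W" and [simp]: "X \<in> Obj C"
  shows "\<B> X W \<cdot> (\<I> X \<boxtimes> i) = i \<boxtimes> \<I> X"
  using assms braid_natural[of "\<I> X" i] by (simp add: Hom_iff Braid_Unit)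

text \<open>
  Moving the strand \<open>V\<close> across the counit turns \<open>\<I> V \<boxtimes> e\<close> into \<open>e \<boxtimes> \<I> V\<close> at the price of two
  crossings \<open>?br \<cdot> ?bl\<close>, and likewise for the unit.  Of the four crossings,
  one is absorbed by the symmetry of \<open>i\<close>, two then cancel, and the last one is absorbed by the
  symmetry of \<open>e\<close>; what remains is the given zig-zag.
\<close>

lemma dual_pair_duality_structure:
  assumes V [simp]: "V \<in> Obj C" and "duality_structure C V (i, e)"
  shows "dual_pair V V i e"
proof -
  have h: "i \<in> Hom C \<U> (V \<diamondop> V)" "e \<in> Hom C (V \<diamondop> V) \<U>"
    and sym: "\<B> V V \<cdot> i = i" "e \<cdot> \<B> V V = e"
    and z: "(e \<boxtimes> \<I> V) \<cdot> (\<I> V \<boxtimes> i) = \<I> V"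
    using assms(2) by (simp_all add: duality_structure_def)
  have [simp]: "i \<in> Arr C" "Dom C i = \<U>" "Cod C i = V \<diamondop> V" "e \<in> Arr C" "Dom C e = V \<diamondop> V" "Cod C e = \<U>"
    using h by (simp_all add: Hom_iff)
  let ?bl = "\<B> V V \<boxtimes> \<I> V" and ?br = "\<I> V \<boxtimes> \<B> V V"
  have bl: "?bl \<cdot> (i \<boxtimes> \<I> V) = i \<boxtimes> \<I> V" "(e \<boxtimes> \<I> V) \<cdot> ?bl = e \<boxtimes> \<I> V"
    by (simp_all add: interchange sym)
  have "(\<I> V \<boxtimes> e) \<cdot> (i \<boxtimes> \<I> V) = ((e \<boxtimes> \<I> V) \<cdot> ?br \<cdot> ?bl) \<cdot> (i \<boxtimes> \<I> V)"
    using braid_counit_natural[OF h(2) V] by (simp add: Braid_TensO)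
  also have "\<dots> = (e \<boxtimes> \<I> V) \<cdot> ?br \<cdot> (?bl \<cdot> (i \<boxtimes> \<I> V))"
    by simp
  also have "?bl \<cdot> (i \<boxtimes> \<I> V) = ?br \<cdot> ?bl \<cdot> (\<I> V \<boxtimes> i)"
    unfolding bl using braid_unit_natural[OF h(1) V] by (simp add: Braid_TensO)
  also have "(e \<boxtimes> \<I> V) \<cdot> ?br \<cdot> \<dots> = ((e \<boxtimes> \<I> V) \<cdot> ?bl) \<cdot> (\<I> V \<boxtimes> i)"
    by (simp add: interchange_assoc Braid_Braid TensM_Id)
  also have "\<dots> = \<I> V"
    by (simp only: bl z)
  finally show ?thesis
    using h z by (simp add: dual_pair_def)
qed

text \<open>
  The nested unit consists of an outer cup \<open>i\<close> on \<open>X\<close>, \<open>X'\<close> and an inner cup \<open>j\<close> on \<open>Y\<close>, \<open>Y'\<close>.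
  Naturality lets the crossed inner cup be pulled through the strand \<open>X\<close>, out of the outer cup, and
  the outer cup be pulled through the strand \<open>Y\<close>, into the inner cup, where its own crossing remains.
\<close>

lemma braid_unit_tensor:
  assumes X [simp]: "X \<in> Obj C" "X' \<in> Obj C" and Y [simp]: "Y \<in> Obj C" "Y' \<in> Obj C"
    and i: "i \<in> Hom C \<U> (X \<diamondop> X')" and j: "j \<in> Hom C \<U> (Y \<diamondop> Y')"
  shows "\<B> (X \<diamondop> Y) (Y' \<diamondop> X') \<cdot> (\<I> X \<boxtimes> j \<boxtimes> \<I> X') \<cdot> i =
    (\<I> Y' \<boxtimes> (\<B> X X' \<cdot> i) \<boxtimes> \<I> Y) \<cdot> \<B> Y Y' \<cdot> j"
proof -
  define j' where "j' = \<B> Y Y' \<cdot> j"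
  have [simp]: "i \<in> Arr C" "Dom C i = \<U>" "Cod C i = X \<diamondop> X'" "j \<in> Arr C" "Dom C j = \<U>" "Cod C j = Y \<diamondop> Y'"
    using i j by (simp_all add: Hom_iff)
  have [simp]: "j' \<in> Arr C" "Dom C j' = \<U>" "Cod C j' = Y' \<diamondop> Y"
    by (simp_all add: j'_def)
  \<comment> \<open>The crossed inner cup passes the strand \<open>X\<close> that lies to its left.\<close>
  have pass: "(\<B> X Y' \<boxtimes> \<I> Y) \<cdot> (\<I> X \<boxtimes> j') = (\<I> Y' \<boxtimes> \<B> Y X) \<cdot> (j' \<boxtimes> \<I> X)"
  proof -
    have "(\<I> Y' \<boxtimes> \<B> Y X) \<cdot> (j' \<boxtimes> \<I> X) = (\<I> Y' \<boxtimes> \<B> Y X) \<cdot> (\<B> X (Y' \<diamondop> Y) \<cdot> (\<I> X \<boxtimes> j'))"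
      by (subst braid_unit_natural) (simp_all add: Hom_iff)
    also have "\<dots> = (\<B> X Y' \<boxtimes> \<I> Y) \<cdot> (\<I> X \<boxtimes> j')"
      by (simp add: Braid_TensO interchange_assoc Braid_Braid TensM_Id)
    finally show ?thesis ..
  qed
  have "\<B> (X \<diamondop> Y) (Y' \<diamondop> X') \<cdot> (\<I> X \<boxtimes> j \<boxtimes> \<I> X') \<cdot> i
      = (\<I> Y' \<boxtimes> \<B> (X \<diamondop> Y) X') \<cdot> ((\<B> (X \<diamondop> Y) Y' \<cdot> (\<I> X \<boxtimes> j)) \<boxtimes> \<I> X') \<cdot> i"
    by (subst Braid_TensO) (simp_all add: whisker_right)
  also have "\<B> (X \<diamondop> Y) Y' \<cdot> (\<I> X \<boxtimes> j) = (\<I> Y' \<boxtimes> \<B> Y X) \<cdot> (j' \<boxtimes> \<I> X)"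
    by (simp add: Braid_TensO_left interchange j'_def[symmetric] pass)
  also have "(\<I> Y' \<boxtimes> \<B> (X \<diamondop> Y) X') \<cdot> (\<dots> \<boxtimes> \<I> X') \<cdot> i
      = (\<I> Y' \<boxtimes> (\<B> (X \<diamondop> Y) X' \<cdot> (\<B> Y X \<boxtimes> \<I> X'))) \<cdot> (j' \<boxtimes> \<I> (X \<diamondop> X')) \<cdot> i"
    by (simp add: whisker_right whisker_left flip: TensM_Id)
  also have "\<B> (X \<diamondop> Y) X' \<cdot> (\<B> Y X \<boxtimes> \<I> X') = (\<B> X X' \<boxtimes> \<I> Y) \<cdot> \<B> Y (X \<diamondop> X')"
    by (simp add: Braid_TensO_left Braid_TensO)
  also have "(j' \<boxtimes> \<I> (X \<diamondop> X')) \<cdot> i = (\<I> (Y' \<diamondop> Y) \<boxtimes> i) \<cdot> j'"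
    using interchange[of "\<I> \<U>" j' i "\<I> (X \<diamondop> X')"] interchange[of j' "\<I> (Y' \<diamondop> Y)" "\<I> \<U>" i] by simp
  also have "(\<I> Y' \<boxtimes> ((\<B> X X' \<boxtimes> \<I> Y) \<cdot> \<B> Y (X \<diamondop> X'))) \<cdot> \<dots>
      = (\<I> Y' \<boxtimes> ((\<B> X X' \<boxtimes> \<I> Y) \<cdot> (\<B> Y (X \<diamondop> X') \<cdot> (\<I> Y \<boxtimes> i)))) \<cdot> j'"
    by (simp add: whisker_left flip: TensM_Id)
  also have "\<B> Y (X \<diamondop> X') \<cdot> (\<I> Y \<boxtimes> i) = i \<boxtimes> \<I> Y"
    by (rule braid_unit_natural[OF i Y(1)])
  also have "(\<B> X X' \<boxtimes> \<I> Y) \<cdot> (i \<boxtimes> \<I> Y) = (\<B> X X' \<cdot> i) \<boxtimes> \<I> Y"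
    by (simp add: whisker_right)
  finally show ?thesis
    by (simp add: j'_def)
qed

end


section \<open>Evaluating formal expressions\<close>

locale self_dual_family = symmetric_strict_monoidal_category C
  for C :: "('o, 'm, 'x) smcat_scheme" +
  fixes V :: "nat \<Rightarrow> 'o" and i e :: "nat \<Rightarrow> 'm"
  assumes V_Obj [simp]: "V k \<in> Obj C"
    and duality: "duality_structure C (V k) (i k, e k)"
begin

lemma i_typing [simp]: "i k \<in> Arr C" "Dom C (i k) = \<U>" "Cod C (i k) = V k \<diamondop> V k"
  and e_typing [simp]: "e k \<in> Arr C" "Dom C (e k) = V k \<diamondop> V k" "Cod C (e k) = \<U>"
  and i_sym: "\<B> (V k) (V k) \<cdot> i k = i k"
  using duality[of k] by (auto simp: duality_structure_def Hom_iff)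

primrec val_obj :: "nat list \<Rightarrow> 'o" where
  "val_obj [] = \<U>"
| "val_obj (k # X) = V k \<diamondop> val_obj X"

primrec val_unit :: "nat list \<Rightarrow> 'm" where
  "val_unit [] = \<I> \<U>"
| "val_unit (k # X) = (\<I> (V k) \<boxtimes> val_unit X \<boxtimes> \<I> (V k)) \<cdot> i k"

text \<open>
  The category \<open>cBr\<close> has no relation for the counit of a tensor product; the clause for \<open>k # X\<close> is
  the counit that \<open>dual_pair_tensor\<close> pairs with the unit above.
\<close>

primrec val_counit :: "nat list \<Rightarrow> 'm" where
  "val_counit [] = \<I> \<U>"
| "val_counit (k # X) = val_counit X \<cdot> (\<I> (val_obj (rev X)) \<boxtimes> e k \<boxtimes> \<I> (val_obj X))"

primrec eval :: "br_expr \<Rightarrow> 'm" where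
  "eval (EId X) = \<I> (val_obj X)"
| "eval (EBraid X Y) = \<B> (val_obj X) (val_obj Y)"
| "eval (EUnit X) = val_unit X"
| "eval (ECounit X) = val_counit X"
| "eval (EComp g f) = eval g \<cdot> eval f"
| "eval (ETens f g) = eval f \<boxtimes> eval g"

lemma val_obj_Obj [simp]: "val_obj X \<in> Obj C"
  by (induction X) simp_all

lemma val_obj_append [simp]: "val_obj (X @ Y) = val_obj X \<diamondop> val_obj Y"
  by (induction X) simp_all

lemma dual_pair_val: "dual_pair (val_obj X) (val_obj (rev X)) (val_unit X) (val_counit X)"
proof (induction X)
  case Nil
  show ?case by (simp add: dual_pair_unit)
next
  case (Cons k X)
  from dual_pair_tensor[OF dual_pair_duality_structure[OF V_Obj duality] this]
  show ?case by simp
qed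

lemma val_unit_typing [simp]:
    "val_unit X \<in> Arr C" "Dom C (val_unit X) = \<U>" "Cod C (val_unit X) = val_obj X \<diamondop> val_obj (rev X)"
  and val_counit_typing [simp]:
    "val_counit X \<in> Arr C" "Dom C (val_counit X) = val_obj (rev X) \<diamondop> val_obj X"
    "Cod C (val_counit X) = \<U>"
  using dual_pair_val[of X] by (simp_all add: dual_pair_def Hom_iff)

lemma val_unit_append:
  "val_unit (X @ Y) = (\<I> (val_obj X) \<boxtimes> val_unit Y \<boxtimes> \<I> (val_obj (rev X))) \<cdot> val_unit X"
  by (induction X) (simp_all add: whisker_left whisker_right flip: TensM_Id)

text \<open>
  \<open>braid_unit_tensor\<close> moves the outermost cup \<open>i k\<close> to the innermost place and braids it there,
  which does not change it because \<open>i k\<close> is symmetric; the other cups are treated inductively.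
\<close>

lemma val_unit_rev: "\<B> (val_obj X) (val_obj (rev X)) \<cdot> val_unit X = val_unit (rev X)"
proof (induction X)
  case Nil
  show ?case by (simp add: Braid_Unit)
next
  case (Cons k X)
  then show ?case
    using braid_unit_tensor[of "V k" "V k" "val_obj X" "val_obj (rev X)" "i k" "val_unit X"]
    by (simp add: Hom_iff i_sym val_unit_append TensM_Id)
qed

lemma eval_typing [simp]:
  assumes "wf_expr f"
  shows "eval f \<in> Arr C" "Dom C (eval f) = val_obj (edom f)" "Cod C (eval f) = val_obj (ecod f)"
proof -
  from assms have "eval f \<in> Arr C \<and> Dom C (eval f) = val_obj (edom f) \<and> Cod C (eval f) = val_obj (ecod f)"
    by (induction f) simp_all
  then show "eval f \<in> Arr C" "Dom C (eval f) = val_obj (edom f)" "Cod C (eval f) = val_obj (ecod f)"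
    by simp_all
qed

lemma eval_sound: "f \<approx> g \<Longrightarrow> eval f = eval g"
proof (induction rule: br_eq.induct)
  case (Tens_Comp f g f' g')
  then show ?case by (simp add: interchange)
next
  case (Braid_natural_left f X Y Z)
  then show ?case using braid_natural[of "eval f" "\<I> (val_obj Z)"] by simp
next
  case (Braid_natural_right f X Y Z)
  then show ?case using braid_natural[of "\<I> (val_obj Z)" "eval f"] by simp
next
  case (zigzag_left X)
  show ?case using dual_pair_val[of X] by (simp add: dual_pair_def)
next
  case (zigzag_right X)
  show ?case using dual_pair_val[of X] by (simp add: dual_pair_def)
qed (simp_all add: TensM_Id Braid_TensO Braid_Unit Braid_Braid val_unit_append val_unit_rev)


section \<open>The functor and its uniqueness\<close>

definition brauer_functor :: "(nat list, br_expr set, 'o, 'm) func" where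
  "brauer_functor = Func val_obj (\<lambda>A\<in>Arr cBr. eval (br_rep A))"

lemma brauer_functor_obj [simp]: "on_obj brauer_functor X = val_obj X"
  by (simp add: brauer_functor_def)

lemma brauer_functor_arr [simp]: "wf_expr f \<Longrightarrow> on_arr brauer_functor (br_class f) = eval f"
  using eval_sound[OF br_rep_class[of f]] by (auto simp: brauer_functor_def cBr_Arr)

lemma cBr_dom_cod:
  assumes "wf_expr f"
  shows "Dom cBr (br_class f) = edom f" "Cod cBr (br_class f) = ecod f"
  using cBr_HomI[OF assms, of "edom f" "ecod f"] by (simp_all add: Hom_def)

lemma brauer_functor_monoidal: "symmetric_strict_monoidal_functor cBr C brauer_functor"
proof -
  have "on_arr brauer_functor \<in> Arr cBr \<rightarrow>\<^sub>E Arr C"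
  proof (rule PiE_I)
    show "on_arr brauer_functor A = undefined" if "A \<notin> Arr cBr" for A
      using that by (simp add: brauer_functor_def)
  qed (auto simp: cBr_Arr)
  then show ?thesis
    unfolding symmetric_strict_monoidal_functor_def
    by (auto simp: cBr_Arr cBr_simps cBr_Comp cBr_TensM cBr_dom_cod)
qed

text \<open>
  The generators \<open>EUnit X\<close> are treated by induction on \<open>X\<close> through \<open>Unit_Tens\<close>.  For \<open>ECounit X\<close>
  there is no such recursion; instead its image forms, by functoriality, a dual pair with the unit
  \<open>val_unit X\<close>, and there is only one arrow with this property.
\<close>

lemma brauer_functor_unique:
  assumes G: "symmetric_strict_monoidal_functor cBr C G"
    and gen: "\<And>k. on_obj G [k] = V k" "\<And>k. on_arr G (cBr_unit [k]) = i k"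
  shows "G = brauer_functor"
proof -
  note G' = G[unfolded symmetric_strict_monoidal_functor_def]
  have "on_obj G (X @ Y) = on_obj G X \<diamondop> on_obj G Y" "on_obj G [] = \<U>" for X Y
    using G' by (auto simp: cBr_simps)
  note G_obj = this
  have obj [simp]: "on_obj G X = val_obj X" for X
  proof (induction X)
    case (Cons k X)
    then show ?case using G_obj(1)[of "[k]" X] by (simp add: gen)
  qed (simp add: G_obj)
  let ?G = "\<lambda>f. on_arr G (br_class f)"
  have G_Id: "?G (EId X) = \<I> (val_obj X)" and G_Braid: "?G (EBraid X Y) = \<B> (val_obj X) (val_obj Y)" for X Y
    using G' by (auto simp: cBr_simps)
  have cls: "br_class f \<in> Arr cBr" if "wf_expr f" for f
    using that by (auto simp: cBr_Arr)
  have G_Comp: "?G (EComp g f) = ?G g \<cdot> ?G f" if "wf_expr f" "wf_expr g" "edom g = ecod f" for f g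
    using G' that cls by (simp add: cBr_Comp[symmetric] cBr_dom_cod)
  have G_Tens: "?G (ETens f g) = ?G f \<boxtimes> ?G g" if "wf_expr f" "wf_expr g" for f g
    using G' that cls by (simp add: cBr_TensM[symmetric])
  have G_Arr: "on_arr G \<in> Arr cBr \<rightarrow>\<^sub>E Arr C"
    using G' by simp
  have G_Hom: "?G f \<in> Hom C (val_obj (edom f)) (val_obj (ecod f))" if "wf_expr f" for f
    using G' that cls PiE_mem[OF G_Arr cls] by (simp add: Hom_iff cBr_dom_cod)
  have G_eq: "?G f = ?G g" if "f \<approx> g" for f g
    using that by (simp add: br_class_eqI)
  have G_Unit: "?G (EUnit X) = val_unit X" for X
  proof (induction X)
    case Nil
    show ?case using G_eq[OF br_eq.Unit_Unit] by (simp add: G_Id)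
  next
    case (Cons k X)
    then show ?case
      using G_eq[OF br_eq.Unit_Tens[of "[k]" X]] gen(2)
      by (simp add: G_Comp G_Tens G_Id cBr_unit_def)
  qed
  have G_Counit: "?G (ECounit X) = val_counit X" for X
  proof (rule dual_pair_counit_unique[OF dual_pair_val])
    show "dual_pair (val_obj X) (val_obj (rev X)) (val_unit X) (?G (ECounit X))"
      using G_eq[OF br_eq.zigzag_left[of X]] G_eq[OF br_eq.zigzag_right[of X]] G_Hom[of "ECounit X"]
      by (simp add: dual_pair_def Hom_iff G_Comp G_Tens G_Id G_Unit)
  qed
  have arr: "?G f = eval f" if "wf_expr f" for f
    using that by (induction f) (simp_all add: G_Id G_Braid G_Unit G_Counit G_Comp G_Tens)
  have "on_arr G = on_arr brauer_functor"
  proof (rule PiE_ext)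
    show "on_arr G \<in> Arr cBr \<rightarrow>\<^sub>E Arr C" by (rule G_Arr)
    show "on_arr brauer_functor \<in> Arr cBr \<rightarrow>\<^sub>E Arr C"
      using brauer_functor_monoidal by (simp add: symmetric_strict_monoidal_functor_def)
  qed (auto simp: cBr_Arr arr)
  moreover have "on_obj G = on_obj brauer_functor"
    by (simp add: fun_eq_iff)
  ultimately show ?thesis
    by (rule func.expand[OF conjI[rotated]])
qed

text \<open>
  On a one-letter word the recursive unit and counit are the given ones, since the innermost
  factor is the identity of the unit object.
\<close>

lemma brauer_functor_generators:
  "on_obj brauer_functor [k] = V k" "on_arr brauer_functor (cBr_unit [k]) = i k"
  "on_arr brauer_functor (cBr_counit [k]) = e k"
  by (simp_all add: cBr_unit_def cBr_counit_def TensM_Id)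

end

theorem theorem3p5:
  fixes C :: "((real, real + 'a) module, (real + 'a) lin_map) smcat"
    and V :: "nat \<Rightarrow> (real, real + 'a) module"
    and i e :: "nat \<Rightarrow> (real + 'a) lin_map"
  assumes "schauenburg_Vect C \<xi>"
    and "\<And>k. real_vs (V k)" and "\<And>k. fin_dim (V k)"
    and "\<And>k. duality_structure C (V k) (i k, e k)"
  shows "\<exists>!Y. symmetric_strict_monoidal_functor cBr C Y \<and>
    (\<forall>k. on_obj Y [k] = V k \<and> on_arr Y (cBr_unit [k]) = i k \<and> on_arr Y (cBr_counit [k]) = e k)"
proof -
  interpret schauenburg_Vect C \<xi> by fact
  interpret self_dual_family C V i e
    by unfold_locales (use assms in \<open>simp_all add: C_simps\<close>)
  show ?thesis
    using brauer_functor_monoidal brauer_functor_generators brauer_functor_unique by blast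
qed

end
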